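(* For each positive integer $g$, let $N(g)$ be the number of numerical semigroups of genus $g$. \begin{enumerate} \item Fix $\varepsilon > 0$. Let $A(g)$ be the number of numerical semigroups of genus $g$ satisfying $(2-\varepsilon) m < F < (2+\varepsilon) m$. Then \[\lim_{g \to \infty} \frac{A(g)}{N(g)} = 1.\] \item Let $B(g)$ be the number of numerical semigroups of genus $g$ with $m < 420$. Then \[\lim_{g\to \infty} \frac{B(g)}{N(g)} = 0.\] \item Let $C(g)$ be the number of numerical semigroups of genus $g$ with $g < 1.3667\, m$. Then \[\lim_{g \to \infty} \frac{C(g)}{N(g)} = 0.\] \end{enumerate} Here $m$ and $F$ denote the multiplicity and the Frobenius number of the semigroup being counted.
   Context: A numerical semigroup $S$ is an additive submonoid of $\mathbb{N}=\{0,1,2,\ldots\}$ (containing $0$) such that $\mathbb{N}\setminus S$ is finite. The elements of $\mathbb{N}\setminus S$ are the gaps of $S$; the number of gaps is the genus $g$ of $S$, the largest gap is the Frobenius number $F=F(S)$, and the smallest nonzero element of $S$ is the multiplicity $m=m(S)$. *)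

theory Defs
  imports Complex_Main
begin

definition numerical_semigroup :: "nat set \<Rightarrow> bool" where
  "numerical_semigroup S \<longleftrightarrow>
     0 \<in> S \<and> (\<forall>x\<in>S. \<forall>y\<in>S. x + y \<in> S) \<and> finite (UNIV - S)"

definition gaps :: "nat set \<Rightarrow> nat set" where
  "gaps S = UNIV - S"

definition genus :: "nat set \<Rightarrow> nat" where
  "genus S = card (gaps S)"

text \<open>Unspecified for the semigroup of all natural numbers, which has no gaps; this is the
  only numerical semigroup of genus 0.\<close>

definition frobenius :: "nat set \<Rightarrow> nat" where
  "frobenius S = Max (gaps S)"

definition multiplicity :: "nat set \<Rightarrow> nat" where
  "multiplicity S = (LEAST x. x \<in> S \<and> x \<noteq> 0)"

definition semigroups_of_genus :: "nat \<Rightarrow> nat set set" where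
  "semigroups_of_genus g = {S. numerical_semigroup S \<and> genus S = g}"

lemma gap_less_twice_genus:
  assumes "numerical_semigroup S" and "f \<in> gaps S"
  shows "f < 2 * genus S"
proof -
  have fin: "finite (gaps S)"
    using assms(1) by (simp add: numerical_semigroup_def gaps_def)
  have "{..f} \<subseteq> gaps S \<union> (\<lambda>x. f - x) ` gaps S"
  proof
    fix x assume "x \<in> {..f}"
    then have sum: "x + (f - x) = f" and eq: "x = f - (f - x)" by auto
    have "x \<in> gaps S \<or> f - x \<in> gaps S"
      using assms sum unfolding numerical_semigroup_def gaps_def by (metis DiffE DiffI UNIV_I)
    then show "x \<in> gaps S \<union> (\<lambda>x. f - x) ` gaps S"
      using eq by blast
  qed
  then have "card {..f} \<le> card (gaps S \<union> (\<lambda>x. f - x) ` gaps S)"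
    using fin by (intro card_mono) auto
  also have "\<dots> \<le> card (gaps S) + card ((\<lambda>x. f - x) ` gaps S)"
    by (rule card_Un_le)
  also have "\<dots> \<le> card (gaps S) + card (gaps S)"
    using card_image_le[OF fin] by simp
  finally show ?thesis by (simp add: genus_def)
qed

text \<open>Hence counting semigroups of a given genus with \<^const>\<open>card\<close> is meaningful.\<close>

lemma finite_semigroups_of_genus: "finite (semigroups_of_genus g)"
proof (rule finite_subset)
  show "semigroups_of_genus g \<subseteq> (\<lambda>G. UNIV - G) ` Pow {..<2 * g}"
  proof
    fix S assume "S \<in> semigroups_of_genus g"
    then have "gaps S \<in> Pow {..<2 * g}"
      using gap_less_twice_genus by (auto simp: semigroups_of_genus_def)
    moreover have "S = UNIV - gaps S" by (auto simp: gaps_def)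
    ultimately show "S \<in> (\<lambda>G. UNIV - G) ` Pow {..<2 * g}" by blast
  qed
qed simp

end

(* Let x = 1/phi, so that x + x^2 = 1. At least fib (g + 1) semigroups have genus g, those with
   F < 2m, so a family of semigroups is negligible as soon as the sum of x^genus over it converges.
   A semigroup of multiplicity m is given by its Kunz coordinates k_i (0 < i < m), with
   k_(i+j) <= k_i + k_j and genus = sum of the k_i, so such sums are partition functions.

   Write F = q m + t. Then k_t = q + 1, and k_i + k_(t-i) >= q + 1 for i < t and
   k_i + k_(m+t-i) >= q for i > t: the indices fall into two regions of constrained pairs. For q >= 5
   every pair has total weight below 1. For q = 2, 3, 4 this fails, and one also uses the least index r
   with k_r = 1: stepping by r arranges the pairs into chains with k_(i+r) <= k_i + 1, whose weight is
   bounded by a transfer matrix. Hence the weight of multiplicity m decays exponentially in m, or in t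
   when q = 2, which gives the upper half of part 1. The lower half holds because F <= (2 - eps) m forces
   k_i = 1 for i > (1 - eps) m.

   Part 2 is the finiteness of the weight for each m. In part 3 only F < (2 + eps) m remains, where almost
   all k_i are 1 or 2 with mean x + 2 x^2 = 1.38... > 1.3667, and a Chernoff bound applies. *)

theory Submission
  imports Defs "HOL-Number_Theory.Fib"
begin

section \<open>The inverse of the golden ratio\<close>

text \<open>The base 1/phi is critical: a coordinate free to be 1 or 2 contributes exactly x + x^2 =
  1. This is also why for q = 2 the region above t has weight 1 and gives no decay. The obstacle for
  q = 2, 3, 4 is that pairs constrained only by their sum weigh about 1.146 when the sum is at least
  3 and about 1.056 when it is at least 4. The chain step r depends on the semigroup, so the weight
  is split by q, t and r; the sum over q is geometric, and t and r cost only a factor m^2. If r is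
  large, many entries are chain starts, which gain nothing from the transfer matrix. But then all
  coordinates at indices below r are at least 2, and the constants are chosen so that this
  restriction outweighs the loss: 0.82 * 1.15 < 0.98.\<close>

definition gr :: real where
  "gr = (sqrt 5 - 1) / 2"

lemma gr_bounds: "0.618033 < gr" "gr < 0.618035"
proof -
  have "2.236066 < sqrt 5" by (rule real_less_rsqrt) (simp add: power2_eq_square)
  moreover have "sqrt 5 < 2.23607" by (rule real_less_lsqrt) (simp_all add: power2_eq_square)
  ultimately show "0.618033 < gr" "gr < 0.618035" by (simp_all add: gr_def)
qed

lemma gr_pos: "0 < gr" and gr_less_1: "gr < 1"
  using gr_bounds by simp_all

lemma gr_square: "gr * gr = 1 - gr"
  by (simp add: gr_def field_simps)

lemma gr_power_Suc_Suc: "gr ^ Suc (Suc n) = gr ^ n - gr ^ Suc n"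
proof -
  have "gr ^ Suc (Suc n) = (gr * gr) * gr ^ n" by simp
  then show ?thesis unfolding gr_square by (simp add: algebra_simps)
qed

lemma gr_powers:
  "gr ^ 2 = 1 - gr" "gr ^ 3 = 2 * gr - 1" "gr ^ 4 = 2 - 3 * gr" "gr ^ 5 = 5 * gr - 3"
  "gr ^ 6 = 5 - 8 * gr" "gr ^ 7 = 13 * gr - 8" "gr ^ 8 = 13 - 21 * gr"
  "gr ^ 9 = 34 * gr - 21" "gr ^ 10 = 34 - 55 * gr"
  by (simp_all add: numeral_eq_Suc gr_power_Suc_Suc del: power_Suc)

lemma gr_powers_le:
  "gr ^ 2 \<le> 0.381967" "gr ^ 3 \<le> 0.23607" "gr ^ 4 \<le> 0.145901" "gr ^ 5 \<le> 0.090175"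
  "gr ^ 6 \<le> 0.055736" "gr ^ 7 \<le> 0.034455" "gr ^ 8 \<le> 0.021307" "gr ^ 9 \<le> 0.01319"
  "gr ^ 10 \<le> 0.008185"
  unfolding gr_powers using gr_bounds by simp_all

section \<open>Transfer matrices\<close>

text \<open>Lists whose entries at distance \<open>r\<close> are related by \<open>R\<close>; the first \<open>r\<close> entries start the chains.\<close>

primrec paths :: "'a set \<Rightarrow> (nat \<Rightarrow> 'a \<Rightarrow> bool) \<Rightarrow> ('a \<Rightarrow> 'a \<Rightarrow> bool) \<Rightarrow> nat \<Rightarrow> nat \<Rightarrow> 'a list set" where
  "paths D ok R r 0 = {[]}"
| "paths D ok R r (Suc n) = (\<lambda>(L, s). L @ [s]) `
     (SIGMA L:paths D ok R r n. {s \<in> D. if n < r then ok n s else R (L ! (n - r)) s})"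

lemma length_paths: "L \<in> paths D ok R r n \<Longrightarrow> length L = n"
  by (induction n arbitrary: L) auto

lemma set_paths: "L \<in> paths D ok R r n \<Longrightarrow> set L \<subseteq> D"
  by (induction n arbitrary: L) force+

lemma finite_paths: "finite D \<Longrightarrow> finite (paths D ok R r n)"
  by (induction n) auto

lemma map_upt_in_paths:
  assumes r: "0 < r"
    and "\<And>i. i < n \<Longrightarrow> f i \<in> D" "\<And>i. i < n \<Longrightarrow> i < r \<Longrightarrow> ok i (f i)"
    "\<And>i. i + r < n \<Longrightarrow> R (f i) (f (i + r))"
  shows "map f [0..<n] \<in> paths D ok R r n"
  using assms(2-)
proof (induction n)
  case (Suc n)
  have "map f [0..<n] \<in> paths D ok R r n"
    using Suc.prems by (intro Suc.IH) auto
  moreover have "if n < r then ok n (f n) else R (map f [0..<n] ! (n - r)) (f n)"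
    using Suc.prems(2)[of n] Suc.prems(3)[of "n - r"] r by simp
  ultimately show ?case
    using Suc.prems(1)[of n] by (auto intro!: rev_image_eqI[of "(map f [0..<n], f n)"])
qed simp

text \<open>The potential \<open>H\<close> is an approximate right eigenvector of the transfer matrix of the relation \<open>R\<close>; the
  last element of every chain \<open>i, i + r, i + 2 r, \<dots>\<close> carries the potential 1 instead.\<close>

lemma sum_paths_le:
  fixes w H :: "'a \<Rightarrow> real" and \<beta> :: "nat \<Rightarrow> real"
  assumes fin: "finite D" and r: "0 < r"
    and w: "\<And>s. s \<in> D \<Longrightarrow> 0 \<le> w s" and H: "\<And>s. s \<in> D \<Longrightarrow> 0 \<le> H s"
    and start: "\<And>i. i < N \<Longrightarrow> i < r \<Longrightarrow> (\<Sum>s | s \<in> D \<and> ok i s. w s) \<le> \<beta> i"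
    and startH: "\<And>i. i + r < N \<Longrightarrow> i < r \<Longrightarrow> (\<Sum>s | s \<in> D \<and> ok i s. w s * H s) \<le> \<beta> i"
    and step: "\<And>s. r < N \<Longrightarrow> s \<in> D \<Longrightarrow> (\<Sum>s' | s' \<in> D \<and> R s s'. w s') \<le> \<rho> * H s"
    and stepH: "\<And>s. r < N \<Longrightarrow> s \<in> D \<Longrightarrow> (\<Sum>s' | s' \<in> D \<and> R s s'. w s' * H s') \<le> \<rho> * H s"
    and nonneg: "\<And>i. 0 \<le> \<beta> i" "0 \<le> \<rho>"
  shows "(\<Sum>L\<in>paths D ok R r N. \<Prod>i<N. w (L ! i)) \<le> (\<Prod>i<min N r. \<beta> i) * \<rho> ^ (N - min N r)"
proof -
  define h where "h i s = (if i + r < N then H s else 1)" for i s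
  \<comment> \<open>Only the last r entries can still be continued; each carries its potential until
    its successor at distance r is appended. Truncated subtraction makes this window the whole list
    while n is at most r.\<close>
  define pot where "pot n L = (\<Prod>i<n. w (L ! i)) * (\<Prod>i\<in>{n - r..<n}. h i (L ! i))" for n L
  have h0: "0 \<le> h i s" if "s \<in> D" for i s using H that by (simp add: h_def)
  have pot0: "0 \<le> pot n L" if "L \<in> paths D ok R r n" for n L
    using set_paths[OF that] length_paths[OF that] w h0
    unfolding pot_def by (intro mult_nonneg_nonneg prod_nonneg) (auto simp: subset_iff)
  have "(\<Sum>L\<in>paths D ok R r n. pot n L) \<le> (\<Prod>i<min n r. \<beta> i) * \<rho> ^ (n - min n r)" if "n \<le> N" for n
    using that
  proof (induction n)
    case 0
    then show ?case by (simp add: pot_def)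
  next
    case (Suc n)
    define E where "E L = {s \<in> D. if n < r then ok n s else R (L ! (n - r)) s}" for L
    define c where "c = (if n < r then \<beta> n else \<rho>)"
    have "(\<Sum>L\<in>paths D ok R r (Suc n). pot (Suc n) L)
        = (\<Sum>(L, s)\<in>(SIGMA L:paths D ok R r n. E L). pot (Suc n) (L @ [s]))"
      unfolding paths.simps E_def by (subst sum.reindex) (auto simp: inj_on_def split_def)
    also have "\<dots> = (\<Sum>L\<in>paths D ok R r n. \<Sum>s\<in>E L. pot (Suc n) (L @ [s]))"
      using fin by (subst sum.Sigma) (auto simp: E_def finite_paths)
    also have "\<dots> \<le> (\<Sum>L\<in>paths D ok R r n. c * pot n L)"
    proof (rule sum_mono)
      fix L assume L: "L \<in> paths D ok R r n"
      have len: "length L = n" using length_paths[OF L] .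
      have nth: "L ! i \<in> D" if "i < n" for i using set_paths[OF L] len that by auto
      show "(\<Sum>s\<in>E L. pot (Suc n) (L @ [s])) \<le> c * pot n L"
      proof (cases "n < r")
        case True
        have "pot (Suc n) (L @ [s]) = pot n L * (w s * h n s)" for s
          using True len by (simp add: pot_def nth_append)
        then have "(\<Sum>s\<in>E L. pot (Suc n) (L @ [s])) = pot n L * (\<Sum>s | s \<in> D \<and> ok n s. w s * h n s)"
          using True by (simp add: sum_distrib_left E_def)
        moreover have "(\<Sum>s | s \<in> D \<and> ok n s. w s * h n s) \<le> \<beta> n"
          using start[of n] startH[of n] True Suc.prems
          by (cases "n + r < N") (simp_all add: h_def)
        ultimately show ?thesis
          using mult_left_mono[OF _ pot0[OF L]] True by (simp add: c_def mult.commute[of "\<beta> n"])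
      next
        case False
        \<comment> \<open>The potential without the factor of entry n - r: the successor of that
          entry, appended now, replaces this factor by \<open>w s * h n s\<close>.\<close>
        define A where "A = (\<Prod>i<n. w (L ! i)) * (\<Prod>i\<in>{Suc (n - r)..<n}. h i (L ! i))"
        have A0: "0 \<le> A"
          unfolding A_def using nth w h0 by (intro mult_nonneg_nonneg prod_nonneg) auto
        have "{n - r..<n} = insert (n - r) {Suc (n - r)..<n}" using False r by auto
        moreover have "h (n - r) (L ! (n - r)) = H (L ! (n - r))"
          using False Suc.prems by (simp add: h_def)
        ultimately have potL: "pot n L = A * H (L ! (n - r))"
          by (simp add: pot_def A_def)
        have "Suc n - r = Suc (n - r)" using False by simp
        moreover have "{Suc (n - r)..<Suc n} = insert n {Suc (n - r)..<n}" using r False by auto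
        ultimately have "pot (Suc n) (L @ [s]) = A * (w s * h n s)" for s
          using len by (simp add: pot_def A_def nth_append)
        then have "(\<Sum>s\<in>E L. pot (Suc n) (L @ [s])) = A * (\<Sum>s | s \<in> D \<and> R (L ! (n - r)) s. w s * h n s)"
          using False by (simp add: sum_distrib_left E_def)
        moreover have "(\<Sum>s | s \<in> D \<and> R (L ! (n - r)) s. w s * h n s) \<le> \<rho> * H (L ! (n - r))"
          using step[of "L ! (n - r)"] stepH[of "L ! (n - r)"] False Suc.prems nth[of "n - r"] r
          by (cases "n + r < N") (simp_all add: h_def)
        ultimately show ?thesis
          using mult_left_mono[OF _ A0] False by (simp add: c_def potL mult.left_commute)
      qed
    qed
    also have "\<dots> = c * (\<Sum>L\<in>paths D ok R r n. pot n L)"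
      by (simp add: sum_distrib_left)
    also have "\<dots> \<le> c * ((\<Prod>i<min n r. \<beta> i) * \<rho> ^ (n - min n r))"
      using Suc nonneg by (intro mult_left_mono) (auto simp: c_def)
    also have "\<dots> = (\<Prod>i<min (Suc n) r. \<beta> i) * \<rho> ^ (Suc n - min (Suc n) r)"
      by (auto simp: c_def Suc_diff_le min_def not_less le_Suc_eq)
    finally show ?case .
  qed
  then have "(\<Sum>L\<in>paths D ok R r N. pot N L) \<le> (\<Prod>i<min N r. \<beta> i) * \<rho> ^ (N - min N r)"
    by simp
  moreover have "pot N = (\<lambda>L. \<Prod>i<N. w (L ! i))"
  proof
    fix L
    have "(\<Prod>i\<in>{N - r..<N}. h i (L ! i)) = 1"
      by (rule prod.neutral) (auto simp: h_def)
    then show "pot N L = (\<Prod>i<N. w (L ! i))" unfolding pot_def by simp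
  qed
  ultimately show ?thesis by (simp only:)
qed

section \<open>Weights of pairs of Kunz coordinates\<close>

text \<open>K will be q + 1 below t and q above t: it bounds every coordinate because F is the
  largest gap, and bounds the sum of partners from below because F is a gap.\<close>

definition kpairs :: "nat \<Rightarrow> (nat \<times> nat) set" where
  "kpairs K = {(p, q). p \<in> {1..K} \<and> q \<in> {1..K} \<and> K \<le> p + q}"

definition kweight :: "nat \<times> nat \<Rightarrow> real" where
  "kweight s = gr ^ (fst s + snd s)"

text \<open>Along a chain the first index grows by r while its partner shrinks by r. So the same
  inequality \<open>k (i + r) \<le> k i + 1\<close> is read forwards for the first members and
  backwards for the second.\<close>

definition kstep :: "nat \<times> nat \<Rightarrow> nat \<times> nat \<Rightarrow> bool" where
  "kstep s s' \<longleftrightarrow> fst s' \<le> fst s + 1 \<and> snd s \<le> snd s' + 1"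

text \<open>The flag \<open>f\<close> counts the members of the pair whose index is below the first index with coordinate 1;
  the first member has the smaller index.\<close>

definition kstart :: "nat \<Rightarrow> nat \<times> nat \<Rightarrow> bool" where
  "kstart f s \<longleftrightarrow> (1 \<le> f \<longrightarrow> 2 \<le> fst s) \<and> (2 \<le> f \<longrightarrow> 2 \<le> snd s)"

lemma finite_kpairs: "finite (kpairs K)"
  by (rule finite_subset[of _ "{1..K} \<times> {1..K}"]) (auto simp: kpairs_def)

lemma kweight_nonneg: "0 \<le> kweight s"
  using gr_pos by (simp add: kweight_def)

lemma sum_kpairs:
  fixes h :: "nat \<times> nat \<Rightarrow> real"
  shows "(\<Sum>s | s \<in> kpairs K \<and> P s. h s) =
    (\<Sum>p\<in>{1..K}. \<Sum>q\<in>{1..K}. if K \<le> p + q \<and> P (p, q) then h (p, q) else 0)"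
proof -
  have "{s \<in> kpairs K. P s} = {s \<in> {1..K} \<times> {1..K}. K \<le> fst s + snd s \<and> P s}"
    by (auto simp: kpairs_def)
  then have "(\<Sum>s | s \<in> kpairs K \<and> P s. h s)
      = (\<Sum>s\<in>{1..K} \<times> {1..K}. if K \<le> fst s + snd s \<and> P s then h s else 0)"
    by (simp add: sum.inter_filter)
  then show ?thesis by (simp add: sum.cartesian_product split_def cong: if_cong)
qed

text \<open>\<beta> bounds the weight of a chain start with a given flag, \<rho> the growth per
  further entry. The bound is uniform in N, r and the flags, so one choice of constants per K serves
  all semigroups.\<close>

definition kbound :: "nat \<Rightarrow> (nat \<Rightarrow> real) \<Rightarrow> real \<Rightarrow> bool" where
  "kbound K \<beta> \<rho> \<longleftrightarrow> (\<forall>N r f. 0 < r \<longrightarrow>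
     (\<Sum>L\<in>paths (kpairs K) (\<lambda>i. kstart (f i)) kstep r N. \<Prod>i<N. kweight (L ! i))
       \<le> (\<Prod>i<min N r. \<beta> (f i)) * \<rho> ^ (N - min N r))"

lemma kboundI:
  assumes H: "\<And>s. s \<in> kpairs K \<Longrightarrow> 0 \<le> H s"
    and start: "\<And>f. (\<Sum>s | s \<in> kpairs K \<and> kstart f s. kweight s) \<le> \<beta> f"
    and startH: "\<And>f. (\<Sum>s | s \<in> kpairs K \<and> kstart f s. kweight s * H s) \<le> \<beta> f"
    and step: "\<And>s. s \<in> kpairs K \<Longrightarrow> (\<Sum>s' | s' \<in> kpairs K \<and> kstep s s'. kweight s') \<le> \<rho> * H s"
    and stepH: "\<And>s. s \<in> kpairs K \<Longrightarrow> (\<Sum>s' | s' \<in> kpairs K \<and> kstep s s'. kweight s' * H s') \<le> \<rho> * H s"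
    and \<rho>: "0 \<le> \<rho>"
  shows "kbound K \<beta> \<rho>"
  unfolding kbound_def
proof (intro allI impI)
  fix N r :: nat and f :: "nat \<Rightarrow> nat"
  assume "0 < r"
  moreover have "0 \<le> \<beta> (f i)" for i
    using start[of "f i"] by (rule order_trans[rotated]) (simp add: sum_nonneg kweight_nonneg)
  ultimately show "(\<Sum>L\<in>paths (kpairs K) (\<lambda>i. kstart (f i)) kstep r N. \<Prod>i<N. kweight (L ! i))
       \<le> (\<Prod>i<min N r. \<beta> (f i)) * \<rho> ^ (N - min N r)"
    by (intro sum_paths_le[where H = H]) (use assms in \<open>simp_all add: finite_kpairs kweight_nonneg\<close>)
qed

text \<open>With potential 1 the chain relation is ignored, and the total weight of the pairs serves
  as the rate.\<close>

lemma kbound_const: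
  assumes "(\<Sum>s\<in>kpairs K. kweight s) \<le> \<rho>"
    and "\<And>f. (\<Sum>s | s \<in> kpairs K \<and> kstart f s. kweight s) \<le> \<beta> f"
  shows "kbound K \<beta> \<rho>"
proof (rule kboundI[where H = "\<lambda>_. 1"])
  have "(\<Sum>s' | s' \<in> kpairs K \<and> kstep s s'. kweight s') \<le> (\<Sum>s\<in>kpairs K. kweight s)" for s
    by (intro sum_mono2) (auto simp: finite_kpairs kweight_nonneg)
  from order_trans[OF this assms(1)]
  show "(\<Sum>s' | s' \<in> kpairs K \<and> kstep s s'. kweight s') \<le> \<rho> * 1"
    "(\<Sum>s' | s' \<in> kpairs K \<and> kstep s s'. kweight s' * 1) \<le> \<rho> * 1" for s
    by simp_all
  show "0 \<le> \<rho>" using assms(1) by (rule order_trans[rotated]) (simp add: sum_nonneg kweight_nonneg)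
qed (use assms in auto)

lemma sum_kpairs_all:
  fixes h :: "nat \<times> nat \<Rightarrow> real"
  shows "(\<Sum>s\<in>kpairs K. h s) = (\<Sum>p\<in>{1..K}. \<Sum>q\<in>{1..K}. if K \<le> p + q then h (p, q) else 0)"
  using sum_kpairs[where P = "\<lambda>_. True"] by simp

lemma atLeastAtMost_numerals: "{1..2} = {1, 2::nat}" "{1..3} = {1, 2, 3::nat}" "{1..4} = {1, 2, 3, 4::nat}"
  "{1..5} = {1, 2, 3, 4, 5::nat}"
  by auto

lemma nat_cases_0_1_Suc:
  obtains "f = 0" | "f = 1" | n where "f = Suc (Suc n)"
  by (metis One_nat_def not0_implies_Suc)

lemma ball_kpairs: "(\<forall>s\<in>kpairs K. P s) \<longleftrightarrow> (\<forall>p\<in>{1..K}. \<forall>q\<in>{1..K}. K \<le> p + q \<longrightarrow> P (p, q))"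
  by (auto simp: kpairs_def)

text \<open>An opaque copy of the powers of \<^const>\<open>gr\<close>, which the simplifier does not unfold.\<close>

definition gpow :: "nat \<Rightarrow> real" where
  "gpow n = gr ^ n"

lemma gpow_le:
  "gpow (Suc (Suc 0)) \<le> 0.381967"
  "gpow (Suc (Suc (Suc 0))) \<le> 0.23607"
  "gpow (Suc (Suc (Suc (Suc 0)))) \<le> 0.145901"
  "gpow (Suc (Suc (Suc (Suc (Suc 0))))) \<le> 0.090175"
  "gpow (Suc (Suc (Suc (Suc (Suc (Suc 0)))))) \<le> 0.055736"
  "gpow (Suc (Suc (Suc (Suc (Suc (Suc (Suc 0))))))) \<le> 0.034455"
  "gpow (Suc (Suc (Suc (Suc (Suc (Suc (Suc (Suc 0)))))))) \<le> 0.021307"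
  "gpow (Suc (Suc (Suc (Suc (Suc (Suc (Suc (Suc (Suc 0))))))))) \<le> 0.01319"
  "gpow (Suc (Suc (Suc (Suc (Suc (Suc (Suc (Suc (Suc (Suc 0)))))))))) \<le> 0.008185"
  using gr_powers_le by (simp_all add: gpow_def eval_nat_numeral)

lemma kweight_gpow: "kweight s = gpow (fst s + snd s)"
  by (simp add: kweight_def gpow_def)

lemmas kpairs_eval = sum_kpairs_all sum_kpairs atLeastAtMost_numerals kweight_gpow

text \<open>For K = 2 the condition on the sum is vacuous and the total weight is
  \<open>(gr + gr ^ 2) ^ 2 = 1\<close>: neither loss nor decay.\<close>

lemma kbound_2: "kbound 2 (\<lambda>_. 1) 1"
proof (rule kbound_const)
  show *: "(\<Sum>s\<in>kpairs 2. kweight s) \<le> 1"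
    unfolding kpairs_eval using gr_powers by (simp add: gpow_def eval_nat_numeral)
  show "(\<Sum>s | s \<in> kpairs 2 \<and> kstart f s. kweight s) \<le> 1" for f
    using * by (rule order_trans[rotated]) (intro sum_mono2, auto simp: finite_kpairs kweight_nonneg)
qed

text \<open>The total weight is about 0.876. The start values are shared with K = 4, where one
  coordinate of at least 2 leaves a weight just below 0.82; 0.6724 is 0.82 squared, so that every
  restricted coordinate counts as one factor 0.82. The value 1.15 exceeds 1.146, the weight for K =
  3.\<close>

lemma kbound_5: "kbound 5 (\<lambda>f. if f = 0 then 1.15 else if f = 1 then 0.82 else 0.6724) 0.98"
proof (rule kbound_const)
  show "(\<Sum>s\<in>kpairs 5. kweight s) \<le> 0.98"
    unfolding kpairs_eval using gpow_le by (simp add: eval_nat_numeral)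
  show "(\<Sum>s | s \<in> kpairs 5 \<and> kstart f s. kweight s) \<le> (if f = 0 then 1.15 else if f = 1 then 0.82 else 0.6724)" for f
    using gpow_le unfolding kpairs_eval
    by (cases f rule: nat_cases_0_1_Suc) (simp_all add: eval_nat_numeral kstart_def)
qed

text \<open>In the next two lemmas the potential is an upper bound for the row sums of the transfer matrix, divided
  by 0.98.\<close>

lemma kbound_3: "kbound 3 (\<lambda>f. if f = 0 then 1.15 else 0.98) 0.98"
proof (rule kboundI)
  define H :: "nat \<times> nat \<Rightarrow> real" where
    "H s = (if fst s = 1 then (if snd s = 3 then 0.64 else 0.875) else if snd s = 3 then 0.79 else 1.17)" for s
  show "0 \<le> H s" for s by (simp add: H_def)
  show "(\<Sum>s | s \<in> kpairs 3 \<and> kstart f s. kweight s) \<le> (if f = 0 then 1.15 else 0.98)" for f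
    using gpow_le unfolding kpairs_eval
    by (cases f rule: nat_cases_0_1_Suc) (simp_all add: eval_nat_numeral kstart_def)
  show "(\<Sum>s | s \<in> kpairs 3 \<and> kstart f s. kweight s * H s) \<le> (if f = 0 then 1.15 else 0.98)" for f
    using gpow_le unfolding kpairs_eval
    by (cases f rule: nat_cases_0_1_Suc) (simp_all add: eval_nat_numeral kstart_def H_def)
  have "\<forall>s\<in>kpairs 3. (\<Sum>s' | s' \<in> kpairs 3 \<and> kstep s s'. kweight s') \<le> 0.98 * H s"
    unfolding ball_kpairs kpairs_eval
    using gpow_le by (simp add: eval_nat_numeral kstep_def H_def)
  then show "(\<Sum>s' | s' \<in> kpairs 3 \<and> kstep s s'. kweight s') \<le> 0.98 * H s" if "s \<in> kpairs 3" for s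
    using that by blast
  have "\<forall>s\<in>kpairs 3. (\<Sum>s' | s' \<in> kpairs 3 \<and> kstep s s'. kweight s' * H s') \<le> 0.98 * H s"
    unfolding ball_kpairs kpairs_eval
    using gpow_le by (simp add: eval_nat_numeral kstep_def H_def)
  then show "(\<Sum>s' | s' \<in> kpairs 3 \<and> kstep s s'. kweight s' * H s') \<le> 0.98 * H s" if "s \<in> kpairs 3" for s
    using that by blast
qed simp

lemma kbound_4: "kbound 4 (\<lambda>f. if f = 0 then 1.15 else if f = 1 then 0.82 else 0.6724) 0.98"
proof (rule kboundI)
  define H :: "nat \<times> nat \<Rightarrow> real" where
    "H s = (if 3 \<le> fst s \<and> snd s \<le> 2 then 1.08 else 0.88)" for s
  show "0 \<le> H s" for s by (simp add: H_def)
  show "(\<Sum>s | s \<in> kpairs 4 \<and> kstart f s. kweight s) \<le> (if f = 0 then 1.15 else if f = 1 then 0.82 else 0.6724)" for f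
    using gpow_le unfolding kpairs_eval
    by (cases f rule: nat_cases_0_1_Suc) (simp_all add: eval_nat_numeral kstart_def)
  show "(\<Sum>s | s \<in> kpairs 4 \<and> kstart f s. kweight s * H s) \<le> (if f = 0 then 1.15 else if f = 1 then 0.82 else 0.6724)" for f
    using gpow_le unfolding kpairs_eval
    by (cases f rule: nat_cases_0_1_Suc) (simp_all add: eval_nat_numeral kstart_def H_def)
  have "\<forall>s\<in>kpairs 4. (\<Sum>s' | s' \<in> kpairs 4 \<and> kstep s s'. kweight s') \<le> 0.98 * H s"
    unfolding ball_kpairs kpairs_eval
    using gpow_le by (simp add: eval_nat_numeral kstep_def H_def)
  then show "(\<Sum>s' | s' \<in> kpairs 4 \<and> kstep s s'. kweight s') \<le> 0.98 * H s" if "s \<in> kpairs 4" for s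
    using that by blast
  have "\<forall>s\<in>kpairs 4. (\<Sum>s' | s' \<in> kpairs 4 \<and> kstep s s'. kweight s' * H s') \<le> 0.98 * H s"
    unfolding ball_kpairs kpairs_eval
    using gpow_le by (simp add: eval_nat_numeral kstep_def H_def)
  then show "(\<Sum>s' | s' \<in> kpairs 4 \<and> kstep s s'. kweight s' * H s') \<le> 0.98 * H s" if "s \<in> kpairs 4" for s
    using that by blast
qed simp

section \<open>Geometric series and pair weights for large K\<close>

lemma sum_gr_le: "(\<Sum>c\<le>n. gr ^ c) \<le> 1 / (1 - gr)"
proof -
  have "(1 - gr) * (\<Sum>c\<le>n. gr ^ c) = 1 - gr ^ Suc n"
    by (rule sum_gp_basic)
  also have "\<dots> \<le> 1" using gr_pos by simp
  finally show ?thesis using gr_less_1 by (simp add: field_simps)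
qed

lemma sum_gr_from_le: "(\<Sum>q\<in>{a..b}. gr ^ q) \<le> gr ^ a / (1 - gr)"
proof (cases "a \<le> b")
  case True
  have "(\<Sum>q\<in>{a..b}. gr ^ q) = (\<Sum>i\<le>b - a. gr ^ (a + i))"
    by (rule sum.reindex_bij_witness[of _ "\<lambda>i. a + i" "\<lambda>q. q - a"]) (use True in auto)
  also have "\<dots> = gr ^ a * (\<Sum>i\<le>b - a. gr ^ i)"
    by (simp add: power_add sum_distrib_left)
  also have "\<dots> \<le> gr ^ a * (1 / (1 - gr))"
    using gr_pos by (intro mult_left_mono sum_gr_le) simp
  finally show ?thesis by simp
next
  case False
  then show ?thesis using gr_pos gr_less_1 by simp
qed

text \<open>For each first member p the second is at least K - p, a geometric tail bounded by
  \<open>gr ^ K / (1 - gr)\<close> in total, and \<open>1 - gr = gr ^ 2\<close>.\<close>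

lemma sum_kweight_le: "2 \<le> K \<Longrightarrow> (\<Sum>s\<in>kpairs K. kweight s) \<le> K * gr ^ (K - 2)"
proof -
  assume K: "2 \<le> K"
  have g: "1 - gr = gr ^ 2" by (simp add: gr_powers)
  have "(\<Sum>q\<in>{1..K}. if K \<le> p + q then gr ^ (p + q) else 0) \<le> gr ^ (K - 2)" if p: "p \<in> {1..K}" for p
  proof -
    have "(\<Sum>q\<in>{1..K}. if K \<le> p + q then gr ^ (p + q) else 0) = (\<Sum>q\<in>{max 1 (K - p)..K}. gr ^ (p + q))"
      by (rule sum.mono_neutral_cong_right) auto
    also have "\<dots> = gr ^ p * (\<Sum>q\<in>{max 1 (K - p)..K}. gr ^ q)"
      by (simp add: power_add sum_distrib_left)
    also have "\<dots> \<le> gr ^ p * (gr ^ max 1 (K - p) / (1 - gr))"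
      using gr_pos by (intro mult_left_mono sum_gr_from_le) simp
    also have "\<dots> = gr ^ (p + max 1 (K - p)) / gr ^ 2"
      unfolding g by (simp add: power_add)
    also have "\<dots> \<le> gr ^ K / gr ^ 2"
      using gr_pos gr_less_1 p by (intro divide_right_mono power_decreasing) auto
    also have "\<dots> = gr ^ (K - 2)"
      using K gr_pos by (simp add: power_diff)
    finally show ?thesis .
  qed
  then have "(\<Sum>s\<in>kpairs K. kweight s) \<le> (\<Sum>p\<in>{1..K}. gr ^ (K - 2))"
    unfolding sum_kpairs_all kweight_def by (intro sum_mono) (simp cong: if_cong)
  then show ?thesis by simp
qed

lemma kbound_ge_5:
  assumes "5 \<le> K"
  shows "kbound K (\<lambda>_. 0.98) 0.98"
proof -
  have *: "(\<Sum>s\<in>kpairs K. kweight s) \<le> 0.98"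
  \<comment> \<open>The general bound \<open>K * gr ^ (K - 2)\<close> is about 1.18 at K = 5 and
    drops below 0.98 only from K = 6 on, so K = 5 is summed directly.\<close>
  proof (cases "K = 5")
    case True
    then show ?thesis
      unfolding True kpairs_eval using gpow_le by (simp add: eval_nat_numeral)
  next
    case False
    then have "6 \<le> K" using assms by simp
    then have "real K * gr ^ (K - 2) \<le> 0.98"
    proof (induction K rule: dec_induct)
      case base
      show ?case using gr_powers_le by simp
    next
      case (step n)
      have "Suc n - 2 = Suc (n - 2)" using step by simp
      then have "real (Suc n) * gr ^ (Suc n - 2) = (real (Suc n) * gr) * gr ^ (n - 2)"
        by (simp only: power_Suc mult.assoc)
      also have "\<dots> \<le> real n * gr ^ (n - 2)"
      proof (rule mult_right_mono)
        have "real (Suc n) * gr \<le> real (Suc n) * 0.7"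
          using gr_bounds by (intro mult_left_mono) auto
        also have "\<dots> \<le> real n" using step by simp
        finally show "real (Suc n) * gr \<le> real n" .
      qed (use gr_pos in simp)
      finally show ?case using step by simp
    qed
    then show ?thesis using sum_kweight_le[of K] assms by simp
  qed
  moreover have "(\<Sum>s | s \<in> kpairs K \<and> kstart f s. kweight s) \<le> 0.98" for f
    by (rule order_trans[OF sum_mono2 *]) (auto simp: finite_kpairs kweight_nonneg)
  ultimately show ?thesis by (rule kbound_const)
qed

section \<open>Regions\<close>

text \<open>A region is the open interval between \<open>a\<close> and \<open>b\<close>, read as the list of pairs at the indices
  \<open>a + 1 + i\<close> and \<open>b - 1 - i\<close>. For odd length the middle coordinate is left over; for even length
  \<open>region_mid\<close> is 0.\<close>

definition region_size :: "nat \<Rightarrow> nat \<Rightarrow> nat" where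
  "region_size a b = (b - a - 1) div 2"

definition region :: "(nat \<Rightarrow> nat) \<Rightarrow> nat \<Rightarrow> nat \<Rightarrow> (nat \<times> nat) list" where
  "region k a b = map (\<lambda>i. (k (a + 1 + i), k (b - 1 - i))) [0..<region_size a b]"

definition region_mid :: "(nat \<Rightarrow> nat) \<Rightarrow> nat \<Rightarrow> nat \<Rightarrow> nat" where
  "region_mid k a b = (if even (b - a) then k ((a + b) div 2) else 0)"

definition region_flag :: "nat \<Rightarrow> nat \<Rightarrow> nat \<Rightarrow> nat \<Rightarrow> nat" where
  "region_flag a b r i = of_bool (a + 1 + i < r) + of_bool (b - 1 - i < r)"

text \<open>The reflection of i to a + b - i pairs i with t - i between 0 and t, and with t + m - i
  between t and m, so one predicate covers both regions.\<close>

definition region_ok :: "nat \<Rightarrow> nat \<Rightarrow> nat \<Rightarrow> nat \<Rightarrow> (nat \<Rightarrow> nat) \<Rightarrow> bool" where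
  "region_ok K a b r k \<longleftrightarrow> (\<forall>i. a < i \<and> i < b \<longrightarrow> 1 \<le> k i \<and> k i \<le> K \<and> K \<le> k i + k (a + b - i)
     \<and> (i < r \<longrightarrow> 2 \<le> k i) \<and> (i + r < b \<longrightarrow> k (i + r) \<le> k i + 1))"

lemma region_in_paths:
  assumes "region_ok K a b r k" "0 < r"
  shows "region k a b \<in> paths (kpairs K) (\<lambda>i. kstart (region_flag a b r i)) kstep r (region_size a b)"
  unfolding region_def
proof (rule map_upt_in_paths)
  fix i assume i: "i < region_size a b"
  then have *: "a < a + 1 + i" "a + 1 + i < b" "a < b - 1 - i" "b - 1 - i < b"
    "a + b - (a + 1 + i) = b - 1 - i" "a + 1 + i \<le> b - 1 - i"
    by (auto simp: region_size_def)
  show "(k (a + 1 + i), k (b - 1 - i)) \<in> kpairs K"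
    using assms(1)[unfolded region_ok_def, rule_format, of "a + 1 + i"]
      assms(1)[unfolded region_ok_def, rule_format, of "b - 1 - i"] * by (simp add: kpairs_def)
  have "2 \<le> k j" if "a < j" "j < b" "j < r" for j
    using assms(1) that unfolding region_ok_def by blast
  then show "kstart (region_flag a b r i) (k (a + 1 + i), k (b - 1 - i))"
    using * by (auto simp: kstart_def region_flag_def)
next
  fix i assume i: "i + r < region_size a b"
  have "k (j + r) \<le> k j + 1" if "a < j" "j + r < b" for j
    using assms(1) that unfolding region_ok_def by auto
  from this[of "a + 1 + i"] this[of "b - 1 - (i + r)"]
  show "kstep (k (a + 1 + i), k (b - 1 - i)) (k (a + 1 + (i + r)), k (b - 1 - (i + r)))"
    using i by (auto simp: kstep_def region_size_def add_ac)
qed fact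

text \<open>Induction strips the two outermost indices, which form the first pair. The middle term
  stays the same because a + b and the parity of b - a do.\<close>

lemma sum_region:
  assumes "a < b"
  shows "(\<Sum>i\<in>{a<..<b}. k i) = (\<Sum>i<region_size a b. k (a + 1 + i) + k (b - 1 - i)) + region_mid k a b"
  using assms
proof (induction "b - a" arbitrary: a b rule: less_induct)
  case less
  consider "b = a + 1" | "b = a + 2" | "a + 2 < b" using less.prems by linarith
  then show ?case
  proof cases
    case 1
    then show ?thesis by (simp add: region_size_def region_mid_def)
  next
    case 2
    then have "{a<..<b} = {a + 1}" by auto
    then show ?thesis using 2 by (simp add: region_size_def region_mid_def)
  next
    case 3
    have "{a<..<b} = insert (a + 1) (insert (b - 1) {a + 1<..<b - 1})" using 3 by auto
    then have "(\<Sum>i\<in>{a<..<b}. k i) = k (a + 1) + k (b - 1) + (\<Sum>i\<in>{a + 1<..<b - 1}. k i)"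
      using 3 by simp
    also have "(\<Sum>i\<in>{a + 1<..<b - 1}. k i) = (\<Sum>i<region_size (a + 1) (b - 1). k (a + 1 + 1 + i) + k (b - 1 - 1 - i))
        + region_mid k (a + 1) (b - 1)"
      using 3 by (intro less.hyps) auto
    also have "region_mid k (a + 1) (b - 1) = region_mid k a b"
      using 3 by (simp add: region_mid_def)
    also have "region_size a b = Suc (region_size (a + 1) (b - 1))"
      using 3 by (simp add: region_size_def)
    ultimately show ?thesis
      by (simp add: sum.lessThan_Suc_shift region_size_def del: sum.lessThan_Suc)
  qed
qed

lemma region_inj:
  assumes "region k a b = region k' a b" "region_mid k a b = region_mid k' a b" "a < i" "i < b"
  shows "k i = k' i"
proof -
  have *: "k (a + 1 + j) = k' (a + 1 + j)" "k (b - 1 - j) = k' (b - 1 - j)" if "j < region_size a b" for j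
    using assms(1) that by (auto simp: region_def)
  consider "2 * i < a + b" | "2 * i = a + b" | "a + b < 2 * i" by linarith
  then show ?thesis
  proof cases
    case 1
    then have j: "i - a - 1 < region_size a b" "a + 1 + (i - a - 1) = i"
      using assms(3,4) by (simp_all add: region_size_def)
    from *(1)[OF j(1)] show ?thesis unfolding j(2) .
  next
    case 2
    then have "even (b - a)" "(a + b) div 2 = i" using assms(3,4) by presburger+
    then show ?thesis using assms(2) by (simp add: region_mid_def)
  next
    case 3
    then have j: "b - 1 - i < region_size a b" "b - 1 - (b - 1 - i) = i"
      using assms(3,4) by (simp_all add: region_size_def)
    from *(2)[OF j(1)] show ?thesis unfolding j(2) .
  qed
qed

lemma power_sum_region:
  assumes "a < b"
  shows "gr ^ (\<Sum>i\<in>{a<..<b}. k i) = (\<Prod>i<region_size a b. kweight (region k a b ! i)) * gr ^ region_mid k a b"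
proof -
  have "(\<Prod>i<region_size a b. kweight (region k a b ! i)) = (\<Prod>i<region_size a b. gr ^ (k (a + 1 + i) + k (b - 1 - i)))"
    by (rule prod.cong) (auto simp: region_def kweight_def)
  then show ?thesis
    unfolding sum_region[OF assms] by (simp add: power_add power_sum)
qed

definition region_bound :: "(nat \<Rightarrow> real) \<Rightarrow> real \<Rightarrow> nat \<Rightarrow> nat \<Rightarrow> nat \<Rightarrow> real" where
  "region_bound \<beta> \<rho> a b r = (\<Prod>i<min (region_size a b) r. \<beta> (region_flag a b r i))
     * \<rho> ^ (region_size a b - min (region_size a b) r)"

text \<open>Once m, q, t and r are fixed, the coordinates consist of \<open>k S t\<close>, two lists
  of pairs and two middle coordinates; forgetting the relations between these parts makes the sum
  factor. The coordinate at t gives \<open>gr ^ (q + 1)\<close>, each middle one at most the series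
  \<open>1 / (1 - gr)\<close>.\<close>

lemma sum_two_regions_le:
  fixes k :: "'a \<Rightarrow> nat \<Rightarrow> nat"
  assumes X: "finite X" and t: "0 < t" "t < m" and r: "0 < r"
    and kt: "\<And>S. S \<in> X \<Longrightarrow> k S t = q + 1"
    and ok1: "\<And>S. S \<in> X \<Longrightarrow> region_ok (q + 1) 0 t r (k S)"
    and ok2: "\<And>S. S \<in> X \<Longrightarrow> region_ok q t m r (k S)"
    and inj: "\<And>S S'. S \<in> X \<Longrightarrow> S' \<in> X \<Longrightarrow> (\<And>i. 0 < i \<Longrightarrow> i < m \<Longrightarrow> k S i = k S' i) \<Longrightarrow> S = S'"
    and b1: "kbound (q + 1) \<beta>1 \<rho>1" and b2: "kbound q \<beta>2 \<rho>2"
  shows "(\<Sum>S\<in>X. gr ^ (\<Sum>i\<in>{0<..<m}. k S i))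
    \<le> gr ^ (q + 1) / (1 - gr) ^ 2 * (region_bound \<beta>1 \<rho>1 0 t r * region_bound \<beta>2 \<rho>2 t m r)"
proof -
  define P1 where "P1 = paths (kpairs (q + 1)) (\<lambda>i. kstart (region_flag 0 t r i)) kstep r (region_size 0 t)"
  define P2 where "P2 = paths (kpairs q) (\<lambda>i. kstart (region_flag t m r i)) kstep r (region_size t m)"
  define W1 where "W1 L = (\<Prod>i<region_size 0 t. kweight (L ! i))" for L
  define W2 where "W2 L = (\<Prod>i<region_size t m. kweight (L ! i))" for L
  define \<Phi> where "\<Phi> S = ((region (k S) 0 t, region_mid (k S) 0 t), (region (k S) t m, region_mid (k S) t m))" for S
  define w where "w z = (W1 (fst (fst z)) * gr ^ snd (fst z)) * (W2 (fst (snd z)) * gr ^ snd (snd z))" for z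
  have fin: "finite P1" "finite P2" unfolding P1_def P2_def by (simp_all add: finite_paths finite_kpairs)
  have W0: "0 \<le> W1 L" "0 \<le> W2 L" for L
    unfolding W1_def W2_def by (simp_all add: prod_nonneg kweight_nonneg)
  have "gr ^ (\<Sum>i\<in>{0<..<m}. k S i) = gr ^ (q + 1) * w (\<Phi> S)" if "S \<in> X" for S
  proof -
    have "{0<..<m} = insert t ({0<..<t} \<union> {t<..<m})" using t by auto
    then have "(\<Sum>i\<in>{0<..<m}. k S i) = q + 1 + ((\<Sum>i\<in>{0<..<t}. k S i) + (\<Sum>i\<in>{t<..<m}. k S i))"
      by (subst sum.union_disjoint[symmetric]) (auto simp: kt[OF that])
    then show ?thesis
      using t by (simp add: power_add power_sum_region w_def \<Phi>_def W1_def W2_def mult_ac)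
  qed
  then have factor: "(\<Sum>S\<in>X. gr ^ (\<Sum>i\<in>{0<..<m}. k S i)) = gr ^ (q + 1) * (\<Sum>S\<in>X. w (\<Phi> S))"
    by (simp add: sum_distrib_left)
  have "(\<Sum>S\<in>X. w (\<Phi> S)) = (\<Sum>z\<in>\<Phi> ` X. w z)"
  proof (rule sum.reindex_cong[symmetric])
    show "inj_on \<Phi> X"
    proof (rule inj_onI)
      fix S S' assume SS: "S \<in> X" "S' \<in> X" and eq: "\<Phi> S = \<Phi> S'"
      show "S = S'"
      proof (rule inj[OF SS])
        fix i assume "0 < i" "i < m"
        have e: "region (k S) 0 t = region (k S') 0 t" "region_mid (k S) 0 t = region_mid (k S') 0 t"
          "region (k S) t m = region (k S') t m" "region_mid (k S) t m = region_mid (k S') t m"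
          using eq unfolding \<Phi>_def by blast+
        consider "i < t" | "i = t" | "t < i" by linarith
        then show "k S i = k S' i"
        proof cases
          case 1
          show ?thesis by (rule region_inj[OF e(1,2) \<open>0 < i\<close> 1])
        next
          case 2
          show ?thesis unfolding 2 kt[OF SS(1)] kt[OF SS(2)] ..
        next
          case 3
          show ?thesis by (rule region_inj[OF e(3,4) 3 \<open>i < m\<close>])
        qed
      qed
    qed
  qed simp_all
  \<comment> \<open>The range of the middle coordinates includes 0, the value that stands for an
    absent middle.\<close>
  also have "\<dots> \<le> (\<Sum>z\<in>(P1 \<times> {..q + 1}) \<times> (P2 \<times> {..q + 1}). w z)"
  proof (rule sum_mono2)
    have "region_mid (k S) 0 t \<le> q + 1" if "S \<in> X" for S
    proof -
      have "0 < t div 2" "t div 2 < t" if "even t" using t that by auto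
      then show ?thesis using ok1[OF that] by (auto simp: region_mid_def region_ok_def)
    qed
    moreover have "region_mid (k S) t m \<le> q + 1" if "S \<in> X" for S
    proof -
      have "t < (t + m) div 2" "(t + m) div 2 < m" if "even (m - t)" using t that by presburger+
      then show ?thesis
        using ok2[OF that, unfolded region_ok_def, rule_format, of "(t + m) div 2"] by (auto simp: region_mid_def)
    qed
    ultimately show "\<Phi> ` X \<subseteq> (P1 \<times> {..q + 1}) \<times> (P2 \<times> {..q + 1})"
      using region_in_paths[OF ok1 r] region_in_paths[OF ok2 r] by (auto simp: \<Phi>_def P1_def P2_def)
    show "0 \<le> w z" for z
      using W0 gr_pos by (simp add: w_def)
  qed (use fin in simp)
  also have "\<dots> = ((\<Sum>L\<in>P1. W1 L) * (\<Sum>c\<le>q + 1. gr ^ c)) * ((\<Sum>L\<in>P2. W2 L) * (\<Sum>c\<le>q + 1. gr ^ c))"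
    unfolding sum_product w_def sum.cartesian_product by (simp add: split_def)
  also have "\<dots> \<le> (region_bound \<beta>1 \<rho>1 0 t r * (1 / (1 - gr))) * (region_bound \<beta>2 \<rho>2 t m r * (1 / (1 - gr)))"
  proof -
    have 1: "(\<Sum>L\<in>P1. W1 L) \<le> region_bound \<beta>1 \<rho>1 0 t r"
      unfolding P1_def W1_def region_bound_def by (rule b1[unfolded kbound_def, rule_format, OF r])
    have 2: "(\<Sum>L\<in>P2. W2 L) \<le> region_bound \<beta>2 \<rho>2 t m r"
      unfolding P2_def W2_def region_bound_def by (rule b2[unfolded kbound_def, rule_format, OF r])
    have 3: "0 \<le> (\<Sum>L\<in>P1. W1 L)" "0 \<le> (\<Sum>L\<in>P2. W2 L)" "0 \<le> (\<Sum>c\<le>q + 1. gr ^ c)"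
      using W0 gr_pos by (intro sum_nonneg; simp)+
    then have 4: "0 \<le> region_bound \<beta>1 \<rho>1 0 t r" "0 \<le> region_bound \<beta>2 \<rho>2 t m r"
      using 1 2 by linarith+
    show ?thesis
      by (intro mult_mono 1 2 sum_gr_le mult_nonneg_nonneg 3 4) (use gr_less_1 in simp_all)
  qed
  finally have "gr ^ (q + 1) * (\<Sum>S\<in>X. w (\<Phi> S)) \<le> gr ^ (q + 1) *
      ((region_bound \<beta>1 \<rho>1 0 t r * (1 / (1 - gr))) * (region_bound \<beta>2 \<rho>2 t m r * (1 / (1 - gr))))"
    using gr_pos by (intro mult_left_mono) simp_all
  then show ?thesis
    unfolding factor by (simp add: power2_eq_square mult_ac)
qed

section \<open>Losses and savings at the chain starts\<close>

lemma prod_of_power_if_le: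
  fixes h :: "nat \<Rightarrow> real"
  assumes "finite A" "\<And>i. i \<in> A \<Longrightarrow> 0 \<le> h i" "\<And>i. i \<in> A \<Longrightarrow> h i \<le> (if P i then c else 1) * d ^ f i"
    and "0 \<le> d" "d \<le> 1" "1 \<le> c" "card {i \<in> A. P i} \<le> n" "e \<le> sum f A"
  shows "prod h A \<le> c ^ n * d ^ e"
proof -
  have "prod h A \<le> (\<Prod>i\<in>A. (if P i then c else 1) * d ^ f i)"
    by (rule prod_mono) (use assms in auto)
  also have "\<dots> = (\<Prod>i\<in>A. if P i then c else 1) * d ^ sum f A"
    by (simp add: prod.distrib power_sum)
  also have "(\<Prod>i\<in>A. if P i then c else 1) = c ^ card {i \<in> A. P i}"
    using assms(1) by (simp add: prod.If_cases Int_def)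
  also have "c ^ card {i \<in> A. P i} * d ^ sum f A \<le> c ^ n * d ^ e"
    using assms by (intro mult_mono power_increasing power_decreasing) auto
  finally show ?thesis .
qed

lemma region_bound_nonneg: "(\<And>f. 0 \<le> \<beta> f) \<Longrightarrow> 0 \<le> \<rho> \<Longrightarrow> 0 \<le> region_bound \<beta> \<rho> a b r"
  by (simp add: region_bound_def prod_nonneg)

text \<open>The region begins at index 1, so the first members of its chain starts have indices at
  most r, and only index r itself can be unrestricted: this is the single factor 1.15. The factors
  0.82 count indices below r that belong to a pair; the middle of the region may be lost, hence r -
  2 and not r - 1.\<close>

lemma region_bound_first_le:
  assumes \<beta>: "\<And>f. 0 \<le> \<beta> f" "\<beta> 0 \<le> 1.15" "\<beta> 1 \<le> 0.82" "\<beta> 2 \<le> 0.6724" and r: "0 < r" and t: "0 < t"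
  shows "region_bound \<beta> 0.98 0 t r \<le> 1.15 * 0.82 ^ (if r \<le> t then r - 2 else 2 * region_size 0 t)
     * 0.98 ^ (region_size 0 t - min (region_size 0 t) r)"
proof -
  define n where "n = region_size 0 t"
  have n: "n = (t - 1) div 2" by (simp add: n_def region_size_def)
  let ?fl = "region_flag 0 t r"
  have sum_ge: "(if r \<le> t then r - 2 else 2 * n) \<le> (\<Sum>i<min n r. ?fl i)"
  proof -
    consider "t < r" | "r \<le> n" | "n < r" "r \<le> t" by linarith
    then show ?thesis
    proof cases
      case 1
      then have "(\<Sum>i<min n r. ?fl i) = (\<Sum>i<min n r. 2)"
        by (intro sum.cong) (auto simp: region_flag_def n)
      then show ?thesis using 1 n by simp
    next
      case 2
      have "r - 1 = (\<Sum>i<r - 1. 1)" by simp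
      also have "\<dots> \<le> (\<Sum>i<r - 1. ?fl i)"
        by (intro sum_mono) (auto simp: region_flag_def)
      also have "\<dots> \<le> (\<Sum>i<min n r. ?fl i)"
        using 2 by (intro sum_mono2) auto
      finally have "r - 1 \<le> (\<Sum>i<min n r. ?fl i)" .
      moreover have "r - 2 \<le> r - 1" "r \<le> t" using 2 n by simp_all
      ultimately show ?thesis by simp
    next
      case 3
      \<comment> \<open>All n pairs are chain starts here. Every first member i + 1 is below r, and
        the second member t - 1 - i is below r once i is at least t - r.\<close>
      have "n + (n - (t - r)) = (\<Sum>i<n. 1) + (\<Sum>i\<in>{t - r..<n}. 1)" by simp
      also have "(\<Sum>i\<in>{t - r..<n}. 1 :: nat) \<le> (\<Sum>i\<in>{t - r..<n}. of_bool (t - 1 - i < r))"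
        using 3 t r by (intro sum_mono) auto
      also have "\<dots> \<le> (\<Sum>i<n. of_bool (t - 1 - i < r))"
        by (intro sum_mono2) auto
      also have "(\<Sum>i<n. 1 :: nat) \<le> (\<Sum>i<n. of_bool (i + 1 < r))"
        using 3 by (intro sum_mono) auto
      finally have "n + (n - (t - r)) \<le> (\<Sum>i<n. of_bool (i + 1 < r)) + (\<Sum>i<n. of_bool (t - 1 - i < r))"
        by simp
      also have "\<dots> = (\<Sum>i<min n r. ?fl i)"
        unfolding sum.distrib[symmetric] using 3 by (intro sum.cong) (auto simp: region_flag_def)
      finally have "n + (n - (t - r)) \<le> (\<Sum>i<min n r. ?fl i)" .
      moreover have "r - 2 \<le> n + (n - (t - r))" using n 3 by linarith
      ultimately show ?thesis using 3 by simp
    qed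
  qed
  have "(\<Prod>i<min n r. \<beta> (?fl i)) \<le> 1.15 ^ 1 * 0.82 ^ (if r \<le> t then r - 2 else 2 * n)"
  proof (rule prod_of_power_if_le[where P = "\<lambda>i. ?fl i = 0" and f = ?fl])
    have "{i \<in> {..<min n r}. ?fl i = 0} \<subseteq> {r - 1}" by (auto simp: region_flag_def)
    from card_mono[OF _ this] show "card {i \<in> {..<min n r}. ?fl i = 0} \<le> 1" by simp
    show "\<beta> (?fl i) \<le> (if ?fl i = 0 then 1.15 else 1) * 0.82 ^ ?fl i" for i
    proof -
      have "?fl i \<le> 2" by (simp add: region_flag_def of_bool_def)
      then consider "?fl i = 0" | "?fl i = 1" | "?fl i = 2" by linarith
      then show ?thesis by cases (use \<beta> in \<open>simp_all add: power2_eq_square\<close>)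
    qed
  qed (use \<beta> sum_ge in auto)
  then show ?thesis
    unfolding region_bound_def n_def by (intro mult_right_mono) auto
qed

text \<open>In a pair the second index is the larger one, so these are the starts with flag 0, the
  only ones that may cost 1.15.\<close>

definition region_starts :: "nat \<Rightarrow> nat \<Rightarrow> nat \<Rightarrow> nat" where
  "region_starts a b r = card {i \<in> {..<min (region_size a b) r}. r \<le> a + 1 + i}"

lemma region_bound_le:
  assumes \<beta>: "\<And>f. 0 \<le> \<beta> f" "\<beta> 0 \<le> 1.15" "\<And>f. 0 < f \<Longrightarrow> \<beta> f \<le> 0.98"
  shows "region_bound \<beta> 0.98 a b r \<le> 1.15 ^ region_starts a b r * 0.98 ^ (region_size a b - region_starts a b r)"
proof -
  let ?n = "region_size a b" and ?fl = "region_flag a b r"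
  define z where "z = region_starts a b r"
  let ?P = "\<lambda>i. r \<le> a + 1 + i"
  have z_le: "z \<le> min ?n r"
    unfolding z_def region_starts_def by (rule order_trans[OF card_mono[of "{..<min ?n r}"]]) auto
  have "(\<Prod>i<min ?n r. \<beta> (?fl i)) \<le> 1.15 ^ z * 0.98 ^ (min ?n r - z)"
  proof (rule prod_of_power_if_le[where P = ?P and f = "\<lambda>i. if ?P i then 0 else 1"])
    show "\<beta> (?fl i) \<le> (if ?P i then 1.15 else 1) * 0.98 ^ (if ?P i then 0 else 1)" for i
    proof (cases "?P i")
      case True
      then show ?thesis using \<beta>(2) \<beta>(3)[of "?fl i"] by (cases "?fl i = 0") auto
    next
      case False
      then have "0 < ?fl i" by (auto simp: region_flag_def)
      then show ?thesis using \<beta>(3)[of "?fl i"] False by simp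
    qed
    have "z = (\<Sum>i<min ?n r. if ?P i then 1 else 0)"
      unfolding z_def region_starts_def card_eq_sum by (rule sum.inter_filter) simp
    then have "z + (\<Sum>i<min ?n r. if ?P i then 0 else 1) = (\<Sum>i<min ?n r. (if ?P i then 1 else 0) + (if ?P i then 0 else 1))"
      by (simp only: sum.distrib)
    also have "\<dots> = (\<Sum>i<min ?n r. 1)" by (rule sum.cong) auto
    finally show "min ?n r - z \<le> (\<Sum>i<min ?n r. if ?P i then 0 else 1)" by simp
    show "card {i \<in> {..<min ?n r}. ?P i} \<le> z" by (simp only: z_def region_starts_def order_refl)
  qed (use \<beta>(1) in simp_all)
  then have "region_bound \<beta> 0.98 a b r \<le> (1.15 ^ z * 0.98 ^ (min ?n r - z)) * 0.98 ^ (?n - min ?n r)"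
    unfolding region_bound_def by (intro mult_right_mono) auto
  also have "\<dots> = 1.15 ^ z * 0.98 ^ ((min ?n r - z) + (?n - min ?n r))"
    by (simp only: power_add mult.assoc)
  also have "(min ?n r - z) + (?n - min ?n r) = ?n - z" using z_le by simp
  finally show ?thesis unfolding z_def .
qed

text \<open>Each of the \<open>r - 1\<close> indices below \<open>r\<close> has a coordinate of at least 2, and the saving factor 0.82
  this gives in the first region pays for the factor 1.15 of an unrestricted chain start in the second.\<close>

lemma two_region_bounds_le:
  assumes \<beta>1: "\<And>f. 0 \<le> \<beta>1 f" "\<beta>1 0 \<le> 1.15" "\<beta>1 1 \<le> 0.82" "\<beta>1 2 \<le> 0.6724"
    and \<beta>2: "\<And>f. 0 \<le> \<beta>2 f" "\<beta>2 0 \<le> 1.15" "\<And>f. 0 < f \<Longrightarrow> \<beta>2 f \<le> 0.98"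
    and r: "0 < r" and t: "0 < t" "t < m"
  obtains E where "m \<le> 4 * E + 16" "region_bound \<beta>1 0.98 0 t r * region_bound \<beta>2 0.98 t m r \<le> 2 * 0.98 ^ E"
proof -
  define n1 where "n1 = region_size 0 t"
  define n2 where "n2 = region_size t m"
  define e where "e = (if r \<le> t then r - 2 else 2 * n1)"
  define b where "b = region_starts t m r"
  define c where "c = min b e"
  \<comment> \<open>The exponent e has to cover the starts of both regions, so E bounds n1 and n2
    separately, up to an additive 3, and not their sum. With two coordinates per pair this leads to
    \<open>m \<le> 4 * E + 16\<close>.\<close>
  define E where "E = e + (n1 - min n1 r) + (n2 - b)"
  have n1: "t \<le> 2 * n1 + 2" and n2: "m \<le> t + 2 * n2 + 2"
    by (auto simp: n1_def n2_def region_size_def)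
  have b_min: "b \<le> min n2 r"
    unfolding b_def region_starts_def n2_def by (rule order_trans[OF card_mono[of "{..<min (region_size t m) r}"]]) auto
  \<comment> \<open>For r > t the saving e is only about t, but then the costly starts of the second
    region have first index between r and t + r.\<close>
  have "b \<le> t + 1" if "t < r"
  proof -
    have "{i \<in> {..<min n2 r}. r \<le> t + 1 + i} \<subseteq> {r - t - 1..<r}" by auto
    from card_mono[OF _ this] show ?thesis using that by (simp add: b_def region_starts_def n2_def)
  qed
  then have be: "b \<le> e + 3"
    using b_min n1 by (auto simp: e_def split: if_splits)
  have "n1 \<le> e + (n1 - min n1 r) + 2"
    using r n1 by (auto simp: e_def min_def)
  moreover have "n2 \<le> e + (n2 - b) + 3" using be by linarith
  ultimately have "n1 \<le> E + 2" "n2 \<le> E + 3" by (auto simp: E_def)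
  then have "m \<le> 4 * E + 16" using n1 n2 by linarith
  moreover have "region_bound \<beta>1 0.98 0 t r * region_bound \<beta>2 0.98 t m r \<le> 2 * 0.98 ^ E"
  proof -
    \<comment> \<open>Since 0.82 * 1.15 = 0.943 is below 0.98, c losses are paid for by c savings;
      by \<open>b \<le> e + 3\<close> at most three factors 1.15 remain.\<close>
    have saving: "(0.82 :: real) ^ e * 1.15 ^ b \<le> 1.15 ^ 3 * 0.98 ^ e"
    proof -
      have "(1.15 :: real) ^ b \<le> 1.15 ^ (3 + c)"
        using be by (intro power_increasing) (auto simp: c_def)
      then have "(0.82 :: real) ^ e * 1.15 ^ b \<le> 0.82 ^ e * 1.15 ^ (3 + c)"
        by (intro mult_left_mono) auto
      also have "\<dots> = 0.82 ^ (c + (e - c)) * 1.15 ^ (3 + c)"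
        by (simp add: c_def)
      also have "\<dots> = 1.15 ^ 3 * ((0.82 * 1.15) ^ c * 0.82 ^ (e - c))"
        by (simp only: power_add power_mult_distrib mult_ac)
      also have "\<dots> \<le> 1.15 ^ 3 * (0.98 ^ c * 0.98 ^ (e - c))"
        by (intro mult_left_mono mult_mono power_mono) auto
      also have "(0.98 :: real) ^ c * 0.98 ^ (e - c) = 0.98 ^ e"
        by (simp add: c_def flip: power_add)
      finally show ?thesis .
    qed
    have "region_bound \<beta>1 0.98 0 t r * region_bound \<beta>2 0.98 t m r
        \<le> (1.15 * 0.82 ^ e * 0.98 ^ (n1 - min n1 r)) * (1.15 ^ b * 0.98 ^ (n2 - b))"
      unfolding e_def n1_def n2_def b_def
      by (intro mult_mono region_bound_first_le region_bound_le \<beta>1 \<beta>2 r t region_bound_nonneg) simp_all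
    also have "\<dots> = 1.15 * (0.82 ^ e * 1.15 ^ b) * (0.98 ^ (n1 - min n1 r) * 0.98 ^ (n2 - b))"
      by (simp only: mult_ac)
    also have "\<dots> \<le> 1.15 * (1.15 ^ 3 * 0.98 ^ e) * (0.98 ^ (n1 - min n1 r) * 0.98 ^ (n2 - b))"
      by (intro mult_right_mono mult_left_mono saving) simp_all
    also have "\<dots> = 1.15 ^ 4 * 0.98 ^ E"
    proof -
      have "(1.15 :: real) ^ 4 = 1.15 * 1.15 ^ 3" by (simp add: eval_nat_numeral)
      then show ?thesis unfolding E_def power_add by (simp only: mult_ac)
    qed
    also have "\<dots> \<le> 2 * 0.98 ^ E"
      by (intro mult_right_mono) (simp_all add: eval_nat_numeral)
    finally show ?thesis .
  qed
  ultimately show ?thesis by (rule that)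
qed

section \<open>Exponential decay for fixed q, t and r\<close>

definition \<theta> :: real where
  "\<theta> = root 4 0.98"

lemma theta_pos: "0 < \<theta>" and theta_less_1: "\<theta> < 1"
  by (simp_all add: \<theta>_def)

text \<open>\<open>\<theta> ^ 4 = 0.98\<close> turns the exponent E into one in m or t; the offset
  16 becomes the factor \<open>0.98 ^ 4\<close>.\<close>

lemma power_098_le: "n \<le> 4 * E + 16 \<Longrightarrow> 0.98 ^ E \<le> \<theta> ^ n / 0.98 ^ 4"
proof -
  assume n: "n \<le> 4 * E + 16"
  have "\<theta> ^ 4 = 0.98" by (simp add: \<theta>_def)
  then have "0.98 ^ E * 0.98 ^ 4 = (\<theta> ^ 4) ^ E * (\<theta> ^ 4) ^ 4"
    by (simp only:)
  also have "\<dots> = \<theta> ^ (4 * E + 16)"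
    by (simp add: power_add flip: power_mult)
  also have "\<dots> \<le> \<theta> ^ n"
    using n theta_pos theta_less_1 by (intro power_decreasing) auto
  finally show ?thesis by (simp add: field_simps)
qed

lemma sum_two_regions_exponential:
  fixes k :: "'a \<Rightarrow> nat \<Rightarrow> nat"
  assumes X: "finite X" and t: "0 < t" "t < m" and r: "0 < r" and q: "2 \<le> q"
    and kt: "\<And>S. S \<in> X \<Longrightarrow> k S t = q + 1"
    and ok1: "\<And>S. S \<in> X \<Longrightarrow> region_ok (q + 1) 0 t r (k S)"
    and ok2: "\<And>S. S \<in> X \<Longrightarrow> region_ok q t m r (k S)"
    and inj: "\<And>S S'. S \<in> X \<Longrightarrow> S' \<in> X \<Longrightarrow> (\<And>i. 0 < i \<Longrightarrow> i < m \<Longrightarrow> k S i = k S' i) \<Longrightarrow> S = S'"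
  shows "(\<Sum>S\<in>X. gr ^ (\<Sum>i\<in>{0<..<m}. k S i)) \<le> 16 * gr ^ (q + 1) * \<theta> ^ (if q = 2 then t else m)"
proof -
  define n where "n = (if q = 2 then t else m)"
  obtain E \<beta>1 \<rho>1 \<beta>2 \<rho>2 where E: "n \<le> 4 * E + 16" "kbound (q + 1) \<beta>1 \<rho>1" "kbound q \<beta>2 \<rho>2"
    "region_bound \<beta>1 \<rho>1 0 t r * region_bound \<beta>2 \<rho>2 t m r \<le> 2 * 0.98 ^ E"
  proof -
    let ?\<beta> = "\<lambda>f :: nat. if f = 0 then 1.15 else if f = 1 then 0.82 else 0.6724 :: real"
    let ?\<beta>' = "\<lambda>f :: nat. if f = 0 then 1.15 else 0.98 :: real"
    consider "q = 2" | "q = 3" | "q = 4" | "5 \<le> q" using q by linarith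
    then show ?thesis
    proof cases
      case 1
      have "region_starts 0 t r \<le> 1"
      proof -
        have "{i \<in> {..<min (region_size 0 t) r}. r \<le> 0 + 1 + i} \<subseteq> {r - 1}" by auto
        from card_mono[OF _ this] show ?thesis by (simp add: region_starts_def)
      qed
      then have "1.15 ^ region_starts 0 t r * (0.98 :: real) ^ (region_size 0 t - region_starts 0 t r)
          \<le> 1.15 ^ 1 * 0.98 ^ (region_size 0 t - 1)"
        by (intro mult_mono power_increasing power_decreasing) auto
      also have "\<dots> \<le> 2 * 0.98 ^ (region_size 0 t - 1)"
        by (intro mult_right_mono) auto
      finally have "region_bound ?\<beta>' 0.98 0 t r \<le> 2 * 0.98 ^ (region_size 0 t - 1)"
        by (rule order_trans[OF region_bound_le[where \<beta> = ?\<beta>'], rotated 3]) simp_all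
      \<comment> \<open>The upper region contributes exactly 1, so for q = 2 only the length t of
        the lower region produces decay.\<close>
      moreover have "region_bound (\<lambda>_. 1) 1 t m r = 1" by (simp add: region_bound_def)
      moreover have "n \<le> 4 * (region_size 0 t - 1) + 16"
        using 1 by (simp add: n_def region_size_def)
      ultimately show ?thesis
        using 1 kbound_3 kbound_2 by (intro that[of "region_size 0 t - 1" ?\<beta>' "0.98" "\<lambda>_. 1" "1"]) simp_all
    next
      case 2
      obtain E where "m \<le> 4 * E + 16" "region_bound ?\<beta> 0.98 0 t r * region_bound ?\<beta>' 0.98 t m r \<le> 2 * 0.98 ^ E"
        by (rule two_region_bounds_le[of ?\<beta> ?\<beta>' r t m]) (use t r in auto)
      then show ?thesis
        using 2 kbound_4 kbound_3 by (intro that[of E ?\<beta> "0.98" ?\<beta>' "0.98"]) (simp_all add: n_def)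
    next
      case 3
      obtain E where "m \<le> 4 * E + 16" "region_bound ?\<beta> 0.98 0 t r * region_bound ?\<beta> 0.98 t m r \<le> 2 * 0.98 ^ E"
        by (rule two_region_bounds_le[of ?\<beta> ?\<beta> r t m]) (use t r in auto)
      then show ?thesis
        using 3 kbound_5 kbound_4 by (intro that[of E ?\<beta> "0.98" ?\<beta> "0.98"]) (simp_all add: n_def)
    next
      case 4
      have *: "region_bound (\<lambda>_. 0.98) 0.98 a b r = 0.98 ^ region_size a b" for a b
        unfolding region_bound_def by (simp flip: power_add)
      have "(0.98 :: real) ^ region_size 0 t * 0.98 ^ region_size t m \<le> 2 * 0.98 ^ (region_size 0 t + region_size t m)"
        by (simp add: power_add)
      moreover have "n \<le> 4 * (region_size 0 t + region_size t m) + 16"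
        using 4 t by (simp add: n_def region_size_def)
      ultimately show ?thesis
        using 4 kbound_ge_5[of q] kbound_ge_5[of "q + 1"]
        by (intro that[of "region_size 0 t + region_size t m" "\<lambda>_. 0.98" "0.98" "\<lambda>_. 0.98" "0.98"]) (simp_all only: *)
    qed
  qed
  have "(\<Sum>S\<in>X. gr ^ (\<Sum>i\<in>{0<..<m}. k S i))
      \<le> gr ^ (q + 1) / (1 - gr) ^ 2 * (region_bound \<beta>1 \<rho>1 0 t r * region_bound \<beta>2 \<rho>2 t m r)"
    by (rule sum_two_regions_le[OF X t r kt ok1 ok2 inj E(2,3)])
  also have "\<dots> \<le> gr ^ (q + 1) / (1 - gr) ^ 2 * (2 * (\<theta> ^ n / 0.98 ^ 4))"
    using E(4) power_098_le[OF E(1)] gr_pos by (intro mult_left_mono) auto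
  also have "\<dots> = 2 / ((1 - gr) ^ 2 * 0.98 ^ 4) * (gr ^ (q + 1) * \<theta> ^ n)"
    by (simp add: field_simps)
  also have "\<dots> \<le> 16 * (gr ^ (q + 1) * \<theta> ^ n)"
  proof (rule mult_right_mono)
    have "(0.38 :: real) ^ 2 \<le> (1 - gr) ^ 2" using gr_bounds by (intro power_mono) auto
    then have "0.125 \<le> (1 - gr) ^ 2 * 0.98 ^ 4" by (simp add: eval_nat_numeral)
    then have "2 / ((1 - gr) ^ 2 * 0.98 ^ 4) \<le> 2 / 0.125" by (intro divide_left_mono) auto
    then show "2 / ((1 - gr) ^ 2 * 0.98 ^ 4) \<le> 16" by simp
  qed (use gr_pos theta_pos in simp)
  finally show ?thesis unfolding n_def by (simp only: mult.assoc)
qed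

section \<open>Kunz coordinates\<close>

text \<open>For 0 < i < m this is the number of gaps congruent to i modulo m. Admitting every i lets
  subadditivity hold without reducing indices modulo m.\<close>

definition kunz :: "nat set \<Rightarrow> nat \<Rightarrow> nat" where
  "kunz S i = (LEAST j. i + j * multiplicity S \<in> S)"

text \<open>Excluding the semigroup of all natural numbers makes the Frobenius number an actual gap
  and the multiplicity at least 2.\<close>

locale proper_semigroup =
  fixes S :: "nat set"
  assumes semigroup: "numerical_semigroup S" and proper: "S \<noteq> UNIV"
begin

abbreviation m where "m \<equiv> multiplicity S"

lemma zero_mem: "0 \<in> S" and add_mem: "x \<in> S \<Longrightarrow> y \<in> S \<Longrightarrow> x + y \<in> S" and finite_gaps: "finite (gaps S)"
  using semigroup by (auto simp: numerical_semigroup_def gaps_def)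

lemma large_mem: "\<exists>N. \<forall>n\<ge>N. n \<in> S"
proof -
  obtain N where "\<forall>n\<in>gaps S. n < N"
    using finite_gaps unfolding finite_nat_set_iff_bounded by blast
  then have "n \<notin> gaps S" if "N \<le> n" for n using that leD by blast
  then show ?thesis by (auto simp: gaps_def)
qed

lemma multiplicity_mem: "m \<in> S" and multiplicity_pos: "0 < m"
proof -
  obtain N where "\<forall>n\<ge>N. n \<in> S" using large_mem by blast
  then have "Suc N \<in> S \<and> Suc N \<noteq> 0" by simp
  then have "m \<in> S \<and> m \<noteq> 0" unfolding multiplicity_def by (rule LeastI)
  then show "m \<in> S" "0 < m" by auto
qed

lemma less_multiplicity: "0 < i \<Longrightarrow> i < m \<Longrightarrow> i \<notin> S"
  unfolding multiplicity_def by (auto dest: not_less_Least)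

lemma mult_mem: "j * m \<in> S"
  by (induction j) (auto intro: zero_mem add_mem multiplicity_mem)

lemma multiplicity_ge_2: "2 \<le> m"
proof (rule ccontr)
  assume "\<not> 2 \<le> m"
  then have "m = 1" using multiplicity_pos by simp
  then have "j \<in> S" for j using mult_mem[of j] by simp
  then show False using proper by auto
qed

lemma mem_iff_kunz_le: "i + j * m \<in> S \<longleftrightarrow> kunz S i \<le> j"
proof
  obtain N where N: "\<forall>n\<ge>N. n \<in> S" using large_mem by blast
  have "N \<le> i + N * m" using multiplicity_pos by (simp add: trans_le_add2)
  then have "i + N * m \<in> S" using N by simp
  then have least: "i + kunz S i * m \<in> S" unfolding kunz_def by (rule LeastI)
  assume "kunz S i \<le> j"
  then have eq: "i + j * m = (i + kunz S i * m) + (j - kunz S i) * m"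
    by (simp add: diff_mult_distrib)
  show "i + j * m \<in> S" unfolding eq by (rule add_mem[OF least mult_mem])
qed (simp add: kunz_def Least_le)

lemma kunz_mem: "i + kunz S i * m \<in> S"
  by (simp add: mem_iff_kunz_le)

lemma kunz_zero: "kunz S 0 = 0"
  using mem_iff_kunz_le[of 0 0] zero_mem by simp

lemma kunz_pos: "0 < i \<Longrightarrow> i < m \<Longrightarrow> 1 \<le> kunz S i"
  using mem_iff_kunz_le[of i 0] less_multiplicity by (cases "kunz S i") auto

lemma kunz_add: "kunz S (i + j) \<le> kunz S i + kunz S j"
proof -
  have "(i + kunz S i * m) + (j + kunz S j * m) \<in> S"
    by (rule add_mem[OF kunz_mem kunz_mem])
  then have "(i + j) + (kunz S i + kunz S j) * m \<in> S" by (simp add: algebra_simps)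
  then show ?thesis by (simp only: mem_iff_kunz_le)
qed

lemma mem_iff: "n \<in> S \<longleftrightarrow> kunz S (n mod m) \<le> n div m"
  using mem_iff_kunz_le[of "n mod m" "n div m"] by simp

lemma gaps_eq: "gaps S = (\<lambda>(i, j). i + j * m) ` (SIGMA i:{0<..<m}. {..<kunz S i})"
proof (intro equalityI subsetI)
  fix n assume "n \<in> gaps S"
  then have lt: "n div m < kunz S (n mod m)" using mem_iff by (auto simp: gaps_def)
  then have "n mod m \<noteq> 0" by (intro notI) (simp add: kunz_zero)
  then have "(n mod m, n div m) \<in> (SIGMA i:{0<..<m}. {..<kunz S i})"
    using lt multiplicity_pos by simp
  then show "n \<in> (\<lambda>(i, j). i + j * m) ` (SIGMA i:{0<..<m}. {..<kunz S i})"
    by (rule rev_image_eqI) simp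
next
  fix n assume "n \<in> (\<lambda>(i, j). i + j * m) ` (SIGMA i:{0<..<m}. {..<kunz S i})"
  then show "n \<in> gaps S" by (auto simp: gaps_def mem_iff_kunz_le)
qed

lemma genus_eq: "genus S = (\<Sum>i\<in>{0<..<m}. kunz S i)"
proof -
  have "inj_on (\<lambda>(i, j). i + j * m) (SIGMA i:{0<..<m}. {..<kunz S i})"
  proof (rule inj_onI, clarsimp)
    fix i j i' j' assume "i < m" and "i' < m" and eq: "i + j * m = i' + j' * m"
    have "i = (i + j * m) mod m" using \<open>i < m\<close> by simp
    also have "\<dots> = i'" unfolding eq using \<open>i' < m\<close> by simp
    finally have "i = i'" .
    then show "i = i' \<and> j = j'" using eq multiplicity_pos by simp
  qed
  then show ?thesis unfolding genus_def gaps_eq by (simp add: card_image)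
qed

lemma frobenius_gap: "frobenius S \<in> gaps S" and gap_le_frobenius: "n \<in> gaps S \<Longrightarrow> n \<le> frobenius S"
proof -
  have "gaps S \<noteq> {}" using proper by (auto simp: gaps_def)
  then show "frobenius S \<in> gaps S" unfolding frobenius_def by (rule Max_in[OF finite_gaps])
  show "n \<le> frobenius S" if "n \<in> gaps S"
    unfolding frobenius_def by (rule Max_ge[OF finite_gaps that])
qed

lemma gap_kunz: "0 < i \<Longrightarrow> i < m \<Longrightarrow> i + (kunz S i - 1) * m \<in> gaps S"
  using kunz_pos[of i] by (simp add: gaps_def mem_iff_kunz_le)

abbreviation q where "q \<equiv> frobenius S div m"
abbreviation t where "t \<equiv> frobenius S mod m"

lemma frobenius_mod: "0 < t" "t < m"
proof -
  have "t \<noteq> 0"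
  proof
    assume "t = 0"
    then have "frobenius S = q * m" by (metis add_0_right div_mult_mod_eq)
    then show False using frobenius_gap mult_mem[of q] by (simp add: gaps_def)
  qed
  then show "0 < t" "t < m" using multiplicity_pos by simp_all
qed

text \<open>\<open>i + (kunz S i - 1) * m\<close> is the largest gap in the class of i and cannot
  exceed F = q m + t.\<close>

lemma kunz_le:
  assumes "0 < i" "i < m"
  shows "kunz S i \<le> q + 1" "t < i \<Longrightarrow> kunz S i \<le> q"
proof -
  have le: "i + (kunz S i - 1) * m \<le> t + q * m"
    using gap_le_frobenius[OF gap_kunz[OF assms]] by simp
  have "kunz S i - 1 \<le> q"
  proof (rule ccontr)
    assume "\<not> kunz S i - 1 \<le> q"
    then have "(q + 1) * m \<le> (kunz S i - 1) * m" by (intro mult_right_mono) auto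
    moreover have "(q + 1) * m = q * m + m" by (simp only: add_mult_distrib mult_1)
    ultimately show False using le frobenius_mod(2) by linarith
  qed
  then show "kunz S i \<le> q + 1" by simp
  show "kunz S i \<le> q" if "t < i"
  proof (rule ccontr)
    assume "\<not> kunz S i \<le> q"
    then have "q * m \<le> (kunz S i - 1) * m" by (intro mult_right_mono) auto
    then show False using le that by linarith
  qed
qed

lemma kunz_frobenius: "kunz S t = q + 1"
proof -
  have "\<not> kunz S t \<le> q"
    using mem_iff[of "frobenius S"] frobenius_gap by (simp add: gaps_def)
  then show ?thesis using kunz_le(1)[OF frobenius_mod] by simp
qed

text \<open>The default m applies if no coordinate is 1. A step of length m leaves the range 0 < i <
  m, so the conditions on steps are then vacuous.\<close>

definition first_one where
  "first_one = (LEAST i. 0 < i \<and> (i = m \<or> kunz S i = 1))"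

lemma first_one: "0 < first_one" "first_one \<le> m" "first_one < m \<Longrightarrow> kunz S first_one = 1"
  and before_first_one: "0 < i \<Longrightarrow> i < first_one \<Longrightarrow> 2 \<le> kunz S i"
proof -
  have m: "0 < m \<and> (m = m \<or> kunz S m = 1)" using multiplicity_pos by simp
  from LeastI[of "\<lambda>i. 0 < i \<and> (i = m \<or> kunz S i = 1)", OF m]
  show *: "0 < first_one" "first_one < m \<Longrightarrow> kunz S first_one = 1"
    unfolding first_one_def by auto
  show le: "first_one \<le> m" unfolding first_one_def using m by (rule Least_le)
  assume i: "0 < i" "i < first_one"
  then have "kunz S i \<noteq> 1" using not_less_Least[of i] unfolding first_one_def by blast
  moreover have "1 \<le> kunz S i" using i le by (intro kunz_pos) auto
  ultimately show "2 \<le> kunz S i" by simp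
qed

lemma kunz_add_first_one: "0 < i \<Longrightarrow> i + first_one < m \<Longrightarrow> kunz S (i + first_one) \<le> kunz S i + 1"
  using kunz_add[of i first_one] first_one(3) by simp

lemma region_ok_below: "region_ok (q + 1) 0 t first_one (kunz S)"
  unfolding region_ok_def
proof (intro allI impI conjI; elim conjE)
  fix i assume i: "0 < i" "i < t"
  then have im: "i < m" using frobenius_mod by simp
  show "1 \<le> kunz S i" "kunz S i \<le> q + 1" using kunz_pos kunz_le i im by blast+
  show "q + 1 \<le> kunz S i + kunz S (0 + t - i)"
    using kunz_add[of i "t - i"] kunz_frobenius i by simp
  show "2 \<le> kunz S i" if "i < first_one" using before_first_one i that by blast
  show "kunz S (i + first_one) \<le> kunz S i + 1" if "i + first_one < t"
    using that frobenius_mod i by (intro kunz_add_first_one) auto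
qed

lemma region_ok_above: "region_ok q t m first_one (kunz S)"
  unfolding region_ok_def
proof (intro allI impI conjI; elim conjE)
  fix i assume i: "t < i" "i < m"
  then have i0: "0 < i" by simp
  show "1 \<le> kunz S i" "kunz S i \<le> q" using kunz_pos kunz_le i i0 by blast+
  \<comment> \<open>The two indices add up to t + m, one wrap around m; this extra 1 is why the
    bound is q here and q + 1 below t.\<close>
  have "(i + kunz S i * m) + ((t + m - i) + kunz S (t + m - i) * m) \<in> S"
    by (rule add_mem[OF kunz_mem kunz_mem])
  then have "t + (kunz S i + kunz S (t + m - i) + 1) * m \<in> S"
    using i by (simp add: algebra_simps)
  then show "q \<le> kunz S i + kunz S (t + m - i)"
    unfolding mem_iff_kunz_le kunz_frobenius by simp
  show "2 \<le> kunz S i" if "i < first_one" using before_first_one i0 that by blast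
  show "kunz S (i + first_one) \<le> kunz S i + 1" if "i + first_one < m"
    using that i0 by (intro kunz_add_first_one) auto
qed

end

lemma kunz_inj:
  assumes S: "proper_semigroup S" "proper_semigroup S'" and m: "multiplicity S = multiplicity S'"
    and k: "\<And>i. 0 < i \<Longrightarrow> i < multiplicity S \<Longrightarrow> kunz S i = kunz S' i"
  shows "S = S'"
proof (rule set_eqI)
  fix n
  interpret S: proper_semigroup S by fact
  interpret S': proper_semigroup S' by fact
  have "kunz S (n mod multiplicity S) = kunz S' (n mod multiplicity S)"
    using k[of "n mod multiplicity S"] S.multiplicity_pos S.kunz_zero S'.kunz_zero
    by (cases "n mod multiplicity S = 0") auto
  then show "n \<in> S \<longleftrightarrow> n \<in> S'" by (simp only: S.mem_iff S'.mem_iff m)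
qed

section \<open>Weights of finite families of fixed multiplicity\<close>

definition proper_semigroups :: "nat \<Rightarrow> nat set set" where
  "proper_semigroups m = {S. proper_semigroup S \<and> multiplicity S = m}"

text \<open>Only the ranges of the single coordinates enter, so the sum factors over the indices.
  The base z is kept general because the Chernoff argument uses one below \<open>gr\<close>.\<close>

lemma sum_power_genus_le_prod:
  fixes D :: "nat \<Rightarrow> nat set" and z :: real
  assumes X: "finite X" "X \<subseteq> proper_semigroups m" and z: "0 \<le> z" and D: "\<And>i. finite (D i)"
    and k: "\<And>S i. S \<in> X \<Longrightarrow> 0 < i \<Longrightarrow> i < m \<Longrightarrow> kunz S i \<in> D i"
  shows "(\<Sum>S\<in>X. z ^ genus S) \<le> (\<Prod>i\<in>{0<..<m}. \<Sum>j\<in>D i. z ^ j)"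
proof (cases "m \<le> 1")
  case True
  have "S \<notin> X" for S
  proof
    assume "S \<in> X"
    then have "proper_semigroup S" "multiplicity S = m" using X(2) by (auto simp: proper_semigroups_def)
    then show False using proper_semigroup.multiplicity_ge_2[of S] True by simp
  qed
  then have "X = {}" by blast
  then show ?thesis using z by (simp add: prod_nonneg sum_nonneg)
next
  case False
  define E where "E = (\<Union>i<m. D i)"
  \<comment> \<open>The chain distance equals the length, so every entry is a start and
    \<open>paths\<close> is a plain product of the sets D; the rate 0 later occurs only to the power
    0.\<close>
  define P where "P = paths E (\<lambda>i s. s \<in> D (Suc i)) (\<lambda>_ _. True) (m - 1) (m - 1)"
  define \<Phi> where "\<Phi> S = map (\<lambda>i. kunz S (Suc i)) [0..<m - 1]" for S
  define w where "w L = (\<Prod>i<m - 1. z ^ (L ! i))" for L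
  have E: "finite E" using D by (simp add: E_def)
  have w0: "0 \<le> w L" for L using z by (simp add: w_def prod_nonneg)
  have shift: "(\<Prod>i\<in>{0<..<m}. h i) = (\<Prod>i<m - 1. h (Suc i))" for h :: "nat \<Rightarrow> real"
    by (rule prod.reindex_bij_witness[of _ Suc "\<lambda>i. i - 1"]) auto
  have "(\<Sum>S\<in>X. z ^ genus S) = (\<Sum>S\<in>X. w (\<Phi> S))"
  proof (rule sum.cong)
    fix S assume "S \<in> X"
    then interpret proper_semigroup S using X(2) by (auto simp: proper_semigroups_def)
    have "multiplicity S = m" using X(2) \<open>S \<in> X\<close> by (auto simp: proper_semigroups_def)
    then have "z ^ genus S = (\<Prod>i\<in>{0<..<m}. z ^ kunz S i)"
      unfolding genus_eq by (simp add: power_sum)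
    then show "z ^ genus S = w (\<Phi> S)" unfolding shift by (simp add: w_def \<Phi>_def)
  qed simp
  also have "\<dots> = (\<Sum>L\<in>\<Phi> ` X. w L)"
  proof (rule sum.reindex_cong[symmetric])
    show "inj_on \<Phi> X"
    proof (rule inj_onI)
      fix S S' assume SS: "S \<in> X" "S' \<in> X" and eq: "\<Phi> S = \<Phi> S'"
      show "S = S'"
      proof (rule kunz_inj)
        fix i assume i: "0 < i" "i < multiplicity S"
        then have "i - 1 < m - 1" using SS X(2) by (auto simp: proper_semigroups_def)
        then have "\<Phi> S ! (i - 1) = kunz S i" "\<Phi> S' ! (i - 1) = kunz S' i"
          using i by (simp_all add: \<Phi>_def)
        then show "kunz S i = kunz S' i" using eq by simp
      qed (use SS X(2) in \<open>auto simp: proper_semigroups_def\<close>)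
    qed
  qed simp_all
  also have "\<dots> \<le> (\<Sum>L\<in>P. w L)"
  proof (rule sum_mono2)
    have "\<Phi> S \<in> P" if "S \<in> X" for S
      unfolding \<Phi>_def P_def
    proof (rule map_upt_in_paths)
      fix i assume i: "i < m - 1"
      then show "kunz S (Suc i) \<in> D (Suc i)" using k[OF that, of "Suc i"] by simp
      then show "kunz S (Suc i) \<in> E" using i by (auto simp: E_def)
    qed (use False in auto)
    then show "\<Phi> ` X \<subseteq> P" by blast
  qed (use E w0 in \<open>auto simp: P_def finite_paths\<close>)
  also have "\<dots> \<le> (\<Prod>i<min (m - 1) (m - 1). \<Sum>j\<in>D (Suc i). z ^ j) * 0 ^ (m - 1 - min (m - 1) (m - 1))"
    unfolding P_def w_def
  proof (rule sum_paths_le[where H = "\<lambda>_. 1"])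
    fix i assume "i < m - 1"
    then have "{s. s \<in> E \<and> s \<in> D (Suc i)} = D (Suc i)" by (auto simp: E_def)
    then show "(\<Sum>s | s \<in> E \<and> s \<in> D (Suc i). z ^ s) \<le> (\<Sum>j\<in>D (Suc i). z ^ j)" by simp
  qed (use E False z in \<open>auto simp: sum_nonneg\<close>)
  also have "\<dots> = (\<Prod>i\<in>{0<..<m}. \<Sum>j\<in>D i. z ^ j)" unfolding shift by simp
  finally show ?thesis .
qed

text \<open>\<open>sum_two_regions_exponential\<close> bounds each fibre of fixed q, t and r. The
  sum over q is geometric, and t and r take at most m values each.\<close>

lemma sum_far_le:
  assumes X: "finite X" "X \<subseteq> proper_semigroups m" and n: "\<And>S. S \<in> X \<Longrightarrow> 2 * m \<le> frobenius S \<and>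
      n \<le> (if frobenius S div m = 2 then frobenius S mod m else m)"
  shows "(\<Sum>S\<in>X. gr ^ genus S) \<le> 16 / (1 - gr) * real m ^ 2 * \<theta> ^ n"
proof -
  define h where "h S = (frobenius S div m, frobenius S mod m, proper_semigroup.first_one S)" for S
  have S: "proper_semigroup S" "multiplicity S = m" if "S \<in> X" for S
    using X(2) that by (auto simp: proper_semigroups_def)
  have fibre: "(\<Sum>S | S \<in> X \<and> h S = y. gr ^ genus S) \<le> 16 * gr ^ fst y * \<theta> ^ n" if "y \<in> h ` X" for y
  proof -
    obtain S0 where S0: "S0 \<in> X" "y = h S0" using \<open>y \<in> h ` X\<close> by blast
    interpret S0: proper_semigroup S0 using S S0 by blast
    have mS0: "multiplicity S0 = m" using S S0 by blast
    obtain q t r where y: "y = (q, t, r)" by (cases y)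
    have qtr: "q = frobenius S0 div m" "t = frobenius S0 mod m" "r = S0.first_one"
      using S0(2) y by (simp_all add: h_def)
    have "2 \<le> q" using n[OF S0(1)] S0.multiplicity_pos by (simp add: qtr mS0 less_eq_div_iff_mult_less_eq)
    have "(\<Sum>S | S \<in> X \<and> h S = y. gr ^ genus S)
        = (\<Sum>S | S \<in> X \<and> h S = y. gr ^ (\<Sum>i\<in>{0<..<m}. kunz S i))"
      using S by (intro sum.cong) (auto simp: proper_semigroup.genus_eq)
    also have "\<dots> \<le> 16 * gr ^ (q + 1) * \<theta> ^ (if q = 2 then t else m)"
    proof (rule sum_two_regions_exponential)
      show "0 < t" "t < m" using S0.frobenius_mod by (simp_all add: qtr mS0)
      show "0 < r" using S0.first_one(1) by (simp add: qtr)
      fix S assume "S \<in> {S \<in> X. h S = y}"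
      then have SX: "S \<in> X" and hS: "frobenius S div m = q" "frobenius S mod m = t" "proper_semigroup.first_one S = r"
        by (auto simp: y h_def)
      interpret proper_semigroup S using S SX by blast
      have mS: "multiplicity S = m" using S SX by blast
      show "kunz S t = q + 1" "region_ok (q + 1) 0 t r (kunz S)" "region_ok q t m r (kunz S)"
        using kunz_frobenius region_ok_below region_ok_above unfolding mS hS by blast+
    next
      fix S S' assume "S \<in> {S \<in> X. h S = y}" "S' \<in> {S \<in> X. h S = y}"
        and eq: "\<And>i. 0 < i \<Longrightarrow> i < m \<Longrightarrow> kunz S i = kunz S' i"
      then show "S = S'" using S by (intro kunz_inj) auto
    qed (use X \<open>2 \<le> q\<close> in auto)
    also have "\<dots> \<le> 16 * gr ^ q * \<theta> ^ n"
      using n[OF S0(1)] gr_pos gr_less_1 theta_pos theta_less_1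
      by (intro mult_mono power_decreasing) (auto simp: qtr)
    finally show ?thesis by (simp add: y)
  qed
  define Q where "Q = Max (insert 0 ((\<lambda>S. frobenius S div m) ` X))"
  have sub: "h ` X \<subseteq> {..Q} \<times> {..<m} \<times> {1..m}"
  proof
    fix y assume "y \<in> h ` X"
    then obtain S0 where S0: "S0 \<in> X" "y = h S0" by blast
    interpret S0: proper_semigroup S0 using S S0 by blast
    have mS0: "multiplicity S0 = m" using S S0 by blast
    have "frobenius S0 div m \<le> Q" using X S0 by (auto simp: Q_def)
    then show "y \<in> {..Q} \<times> {..<m} \<times> {1..m}"
      using S0.first_one S0.frobenius_mod by (simp add: S0(2) h_def mS0 Suc_le_eq)
  qed
  have "(\<Sum>S\<in>X. gr ^ genus S) = (\<Sum>y\<in>h ` X. \<Sum>S | S \<in> X \<and> h S = y. gr ^ genus S)"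
    by (rule sum.image_gen[OF X(1)])
  also have "\<dots> \<le> (\<Sum>y\<in>h ` X. 16 * gr ^ fst y * \<theta> ^ n)"
    by (rule sum_mono) (rule fibre)
  also have "\<dots> \<le> (\<Sum>y\<in>{..Q} \<times> {..<m} \<times> {1..m}. 16 * gr ^ fst y * \<theta> ^ n)"
    using sub gr_pos theta_pos by (intro sum_mono2) auto
  also have "\<dots> = (\<Sum>c\<le>Q. real m ^ 2 * (16 * gr ^ c * \<theta> ^ n))"
    by (subst sum.cartesian_product[symmetric, where g = "\<lambda>c _. 16 * gr ^ c * \<theta> ^ n", unfolded split_def])
       (simp add: power2_eq_square)
  also have "\<dots> = 16 * real m ^ 2 * \<theta> ^ n * (\<Sum>c\<le>Q. gr ^ c)"
    unfolding sum_distrib_left by (rule sum.cong) (simp_all add: mult_ac)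
  also have "\<dots> \<le> 16 * real m ^ 2 * \<theta> ^ n * (1 / (1 - gr))"
    using theta_pos by (intro mult_left_mono sum_gr_le) simp
  finally show ?thesis by simp
qed

section \<open>Negligible families of semigroups\<close>

lemma fib_gr_ge: "gr \<le> real (fib (Suc n)) * gr ^ n"
proof (induction n rule: fib.induct)
  case 1
  then show ?case using gr_less_1 by simp
next
  case 2
  then show ?case by simp
next
  case (3 n)
  \<comment> \<open>Splitting by 1 = gr + gr^2 matches the two terms of the Fibonacci
    recursion.\<close>
  have "gr = gr * gr + gr ^ 2 * gr"
    using gr_powers(1-2) gr_square by (simp only: power2_eq_square power3_eq_cube)
  also have "\<dots> \<le> gr * (real (fib (Suc (Suc n))) * gr ^ Suc n) + gr ^ 2 * (real (fib (Suc n)) * gr ^ n)"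
    using 3 gr_pos by (intro add_mono mult_left_mono) auto
  also have "\<dots> = real (fib (Suc (Suc (Suc n)))) * gr ^ Suc (Suc n)"
    by (simp add: power2_eq_square algebra_simps)
  finally show ?case .
qed

text \<open>For T inside {1..n}, T is the set of indices with Kunz coordinate 2. All gaps lie below
  2 (n + 1), twice the multiplicity, so every choice of T is closed under addition.\<close>

definition depth_2_semigroup :: "nat \<Rightarrow> nat set \<Rightarrow> nat set" where
  "depth_2_semigroup n T = UNIV - ({1..n} \<union> (\<lambda>i. i + (n + 1)) ` T)"

lemma depth_2_semigroup:
  assumes "T \<subseteq> {1..n}"
  shows "numerical_semigroup (depth_2_semigroup n T)" "genus (depth_2_semigroup n T) = n + card T"
proof -
  have fin: "finite T" using assms finite_subset by blast
  have gaps: "gaps (depth_2_semigroup n T) = {1..n} \<union> (\<lambda>i. i + (n + 1)) ` T"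
    by (auto simp: gaps_def depth_2_semigroup_def)
  show "numerical_semigroup (depth_2_semigroup n T)"
    unfolding numerical_semigroup_def
  proof (intro conjI ballI)
    show "0 \<in> depth_2_semigroup n T" by (auto simp: depth_2_semigroup_def)
    show "finite (UNIV - depth_2_semigroup n T)" using gaps fin by (simp add: gaps_def)
    fix x y assume xy: "x \<in> depth_2_semigroup n T" "y \<in> depth_2_semigroup n T"
    show "x + y \<in> depth_2_semigroup n T"
    proof (cases "x = 0 \<or> y = 0")
      case True
      then show ?thesis using xy by auto
    next
      case False
      then have "n < x" "n < y" using xy by (auto simp: depth_2_semigroup_def)
      then have "x + y \<noteq> i + (n + 1)" if "i \<in> T" for i using assms that by fastforce
      moreover have "\<not> x + y \<le> n" using \<open>n < x\<close> by simp
      ultimately show ?thesis by (auto simp: depth_2_semigroup_def)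
    qed
  qed
  have "{1..n} \<inter> (\<lambda>i. i + (n + 1)) ` T = {}" by auto
  then show "genus (depth_2_semigroup n T) = n + card T"
    unfolding genus_def gaps using fin by (simp add: card_Un_disjoint card_image inj_on_def)
qed

lemma multiplicity_depth_2: "multiplicity (depth_2_semigroup n T) = n + 1"
  if "T \<subseteq> {1..n}"
  unfolding multiplicity_def
proof (rule Least_equality)
  show "n + 1 \<in> depth_2_semigroup n T \<and> n + 1 \<noteq> 0"
    using that by (auto simp: depth_2_semigroup_def)
  show "n + 1 \<le> y" if "y \<in> depth_2_semigroup n T \<and> y \<noteq> 0" for y
    using that by (auto simp: depth_2_semigroup_def)
qed

text \<open>With j = card T the multiplicity is g - j + 1, and the pairs (j, T) are counted by the
  diagonal sum of the binomials g - j over j.\<close>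

lemma fib_le_card_semigroups: "fib (Suc g) \<le> card (semigroups_of_genus g)"
proof -
  define A where "A = (SIGMA j:{0..g}. {T. T \<subseteq> {1..g - j} \<and> card T = j})"
  let ?\<Phi> = "\<lambda>(j, T). depth_2_semigroup (g - j) T"
  have "fib (Suc g) = card A"
    unfolding A_def ne_diagonal_fib[symmetric] by (subst card_SigmaI) (auto simp: n_subsets)
  also have "\<dots> = card (?\<Phi> ` A)"
  proof (rule card_image[symmetric], rule inj_onI, clarify)
    fix j T j' T' assume "(j, T) \<in> A" "(j', T') \<in> A"
      and eq: "depth_2_semigroup (g - j) T = depth_2_semigroup (g - j') T'"
    then have T: "j \<le> g" "T \<subseteq> {1..g - j}" "j' \<le> g" "T' \<subseteq> {1..g - j'}" by (auto simp: A_def)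
    have "g - j + 1 = g - j' + 1"
      using multiplicity_depth_2[OF T(2)] multiplicity_depth_2[OF T(4)] eq by simp
    then have j: "j = j'" using T by simp
    have "i \<in> T \<longleftrightarrow> i + (g - j + 1) \<notin> depth_2_semigroup (g - j) T" for i
      by (auto simp: depth_2_semigroup_def)
    moreover have "i \<in> T' \<longleftrightarrow> i + (g - j + 1) \<notin> depth_2_semigroup (g - j) T'" for i
      by (auto simp: depth_2_semigroup_def)
    ultimately have "T = T'" using eq j by blast
    then show "j = j' \<and> T = T'" using j by simp
  qed
  also have "\<dots> \<le> card (semigroups_of_genus g)"
    by (intro card_mono finite_semigroups_of_genus)
       (auto simp: A_def semigroups_of_genus_def depth_2_semigroup)
  finally show ?thesis .
qed

lemma card_semigroups_gr_ge: "gr \<le> real (card (semigroups_of_genus g)) * gr ^ g"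
  using fib_gr_ge[of g] fib_le_card_semigroups[of g] gr_pos
  by (meson mult_right_mono of_nat_le_iff order_trans zero_le_power less_imp_le)

lemma card_semigroups_pos: "0 < card (semigroups_of_genus g)"
  using fib_le_card_semigroups[of g] fib_neq_0_nat[of "Suc g"] by linarith

section \<open>Negligibility and its summability criterion\<close>

definition negligible :: "(nat set \<Rightarrow> bool) \<Rightarrow> bool" where
  "negligible P \<longleftrightarrow> (\<lambda>g. real (card {S \<in> semigroups_of_genus g. P S})
     / real (card (semigroups_of_genus g))) \<longlonglongrightarrow> 0"

lemma proper_if_genus_pos: "S \<in> semigroups_of_genus g \<Longrightarrow> 0 < g \<Longrightarrow> proper_semigroup S"
  by (auto simp: semigroups_of_genus_def proper_semigroup_def genus_def gaps_def)

text \<open>The one semigroup that is not proper has genus 0 and does not affect the limit.\<close>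

lemma negligible_mono:
  assumes "negligible Q" "\<And>S. proper_semigroup S \<Longrightarrow> P S \<Longrightarrow> Q S"
  shows "negligible P"
  unfolding negligible_def
proof (rule real_tendsto_sandwich[OF _ _ tendsto_const assms(1)[unfolded negligible_def]])
  have "card {S \<in> semigroups_of_genus g. P S} \<le> card {S \<in> semigroups_of_genus g. Q S}" if "0 < g" for g
    using assms(2) proper_if_genus_pos that
    by (intro card_mono) (auto simp: finite_semigroups_of_genus)
  then show "\<forall>\<^sub>F g in sequentially. real (card {S \<in> semigroups_of_genus g. P S}) / real (card (semigroups_of_genus g))
      \<le> real (card {S \<in> semigroups_of_genus g. Q S}) / real (card (semigroups_of_genus g))"
    by (intro eventually_sequentiallyI[of 1] divide_right_mono) auto
qed simp

lemma negligible_disj: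
  assumes "negligible P" "negligible Q"
  shows "negligible (\<lambda>S. P S \<or> Q S)"
  unfolding negligible_def
proof (rule real_tendsto_sandwich[OF _ _ tendsto_const])
  show "(\<lambda>g. real (card {S \<in> semigroups_of_genus g. P S}) / real (card (semigroups_of_genus g))
      + real (card {S \<in> semigroups_of_genus g. Q S}) / real (card (semigroups_of_genus g))) \<longlonglongrightarrow> 0"
    using tendsto_add[OF assms[unfolded negligible_def]] by simp
  have "card {S \<in> semigroups_of_genus g. P S \<or> Q S}
      \<le> card {S \<in> semigroups_of_genus g. P S} + card {S \<in> semigroups_of_genus g. Q S}" for g
  proof -
    have "{S \<in> semigroups_of_genus g. P S \<or> Q S} = {S \<in> semigroups_of_genus g. P S} \<union> {S \<in> semigroups_of_genus g. Q S}"
      by blast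
    then show ?thesis by (simp only: card_Un_le)
  qed
  then show "\<forall>\<^sub>F g in sequentially. real (card {S \<in> semigroups_of_genus g. P S \<or> Q S}) / real (card (semigroups_of_genus g))
      \<le> real (card {S \<in> semigroups_of_genus g. P S}) / real (card (semigroups_of_genus g))
       + real (card {S \<in> semigroups_of_genus g. Q S}) / real (card (semigroups_of_genus g))"
    unfolding add_divide_distrib[symmetric] of_nat_add[symmetric]
    by (intro always_eventually allI divide_right_mono) (simp_all only: of_nat_le_iff of_nat_0_le_iff)
qed simp

text \<open>Partial sums over the genus are regrouped by multiplicity. Each group is finite, so
  finite X suffice although infinitely many semigroups can share a multiplicity.\<close>

lemma negligibleI:
  assumes c: "summable c"
    and X: "\<And>m X. finite X \<Longrightarrow> X \<subseteq> proper_semigroups m \<Longrightarrow> (\<And>S. S \<in> X \<Longrightarrow> P S) \<Longrightarrow> (\<Sum>S\<in>X. gr ^ genus S) \<le> c m"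
  shows "negligible P"
proof -
  define Y where "Y g = {S \<in> semigroups_of_genus g. proper_semigroup S \<and> P S}" for g
  define a where "a g = real (card (Y g)) * gr ^ g" for g
  have c0: "0 \<le> c m" for m using X[of "{}" m] by simp
  have fin: "finite (Y g)" for g by (simp add: Y_def finite_semigroups_of_genus)
  have "summable a"
  proof (rule summableI_nonneg_bounded)
    show "0 \<le> a g" for g using gr_pos by (simp add: a_def)
    fix G
    define Z where "Z = (\<Union>g<G. Y g)"
    have finZ: "finite Z" using fin by (simp add: Z_def)
    have "(\<Sum>g<G. a g) = (\<Sum>g<G. \<Sum>S\<in>Y g. gr ^ genus S)"
      by (intro sum.cong) (auto simp: a_def Y_def semigroups_of_genus_def)
    also have "\<dots> = (\<Sum>S\<in>Z. gr ^ genus S)"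
      unfolding Z_def using fin by (intro sum.UNION_disjoint[symmetric]) (auto simp: Y_def semigroups_of_genus_def)
    also have "\<dots> = (\<Sum>m\<in>multiplicity ` Z. \<Sum>S | S \<in> Z \<and> multiplicity S = m. gr ^ genus S)"
      by (rule sum.image_gen[OF finZ])
    also have "\<dots> \<le> (\<Sum>m\<in>multiplicity ` Z. c m)"
    proof (intro sum_mono X)
      show "finite {S \<in> Z. multiplicity S = m}" for m using finZ by simp
    qed (auto simp: proper_semigroups_def Z_def Y_def)
    also have "\<dots> \<le> suminf c"
      using c0 finZ by (intro sum_le_suminf c) auto
    finally show "(\<Sum>g<G. a g) \<le> suminf c" .
  qed
  then have "a \<longlonglongrightarrow> 0" by (rule summable_LIMSEQ_zero)
  then have lim: "(\<lambda>g. a g / gr) \<longlonglongrightarrow> 0" using tendsto_divide_zero by blast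
  have "negligible (\<lambda>S. proper_semigroup S \<and> P S)"
    unfolding negligible_def
  proof (rule real_tendsto_sandwich[OF _ _ tendsto_const lim])
    have "real (card (Y g)) / real (card (semigroups_of_genus g)) \<le> a g / gr" for g
    proof -
      have "real (card (Y g)) / real (card (semigroups_of_genus g))
          = a g / (real (card (semigroups_of_genus g)) * gr ^ g)"
        using gr_pos by (simp add: a_def)
      also have "\<dots> \<le> a g / gr"
        using card_semigroups_gr_ge[of g] gr_pos card_semigroups_pos[of g]
        by (intro divide_left_mono) (auto simp: a_def)
      finally show ?thesis .
    qed
    then show "\<forall>\<^sub>F g in sequentially. real (card {S \<in> semigroups_of_genus g. proper_semigroup S \<and> P S})
        / real (card (semigroups_of_genus g)) \<le> a g / gr"
      by (simp add: Y_def)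
  qed simp
  then show ?thesis by (rule negligible_mono) simp
qed

text \<open>Bernoulli's inequality bounds \<open>m * \<sigma> ^ m\<close> for the fourth root
  \<sigma> of \<tau>. Its square absorbs \<open>m ^ 2\<close> and half of the exponent, leaving a
  geometric series.\<close>

lemma summable_square_power:
  fixes \<tau> :: real
  assumes "0 < \<tau>" "\<tau> < 1"
  shows "summable (\<lambda>m. real m ^ 2 * \<tau> ^ m)"
proof -
  define \<sigma> where "\<sigma> = root 4 \<tau>"
  define \<delta> where "\<delta> = 1 / \<sigma> - 1"
  have \<sigma>: "0 < \<sigma>" "\<sigma> < 1" "\<sigma> ^ 4 = \<tau>" using assms by (simp_all add: \<sigma>_def)
  have \<delta>: "0 < \<delta>" using \<sigma> by (simp add: \<delta>_def)
  have bound: "real m * \<sigma> ^ m \<le> 1 / \<delta>" for m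
  proof -
    have "1 + real m * \<delta> \<le> (1 + \<delta>) ^ m" using \<delta> by (intro Bernoulli_inequality) simp
    then have "real m * \<delta> \<le> (1 / \<sigma>) ^ m" by (simp add: \<delta>_def)
    then show ?thesis using \<sigma> \<delta> by (simp add: power_divide field_simps)
  qed
  show ?thesis
  proof (rule summable_comparison_test')
    show "summable (\<lambda>m. (1 / \<delta>) ^ 2 * (\<sigma> ^ 2) ^ m)"
      using \<sigma> by (intro summable_mult summable_geometric) (simp add: power_less_one_iff)
    show "norm (real m ^ 2 * \<tau> ^ m) \<le> (1 / \<delta>) ^ 2 * (\<sigma> ^ 2) ^ m" for m
    proof -
      have "\<tau> ^ m = (\<sigma> ^ m) ^ 2 * (\<sigma> ^ 2) ^ m"
        unfolding \<sigma>(3)[symmetric] by (simp flip: power_mult power_add)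
      then have "norm (real m ^ 2 * \<tau> ^ m) = (real m * \<sigma> ^ m) ^ 2 * (\<sigma> ^ 2) ^ m"
        by (simp add: power_mult_distrib abs_mult)
      also have "\<dots> \<le> (1 / \<delta>) ^ 2 * (\<sigma> ^ 2) ^ m"
        using bound[of m] \<sigma> by (intro mult_right_mono power_mono) auto
      finally show ?thesis .
    qed
  qed
qed

text \<open>For exponents linear in m up to rounding: c is the slope, d the rounding error.\<close>

lemma power_le_powr_power:
  fixes x c d :: real
  assumes "0 < x" "x \<le> 1" "c * real m - d \<le> real n"
  shows "x ^ n \<le> (x powr c) ^ m * x powr (- d)"
proof -
  have "x ^ n = x powr real n" using assms by (simp add: powr_realpow)
  also have "\<dots> \<le> x powr (c * real m - d)" using assms by (intro powr_mono') auto
  also have "\<dots> = (x powr c) ^ m * x powr (- d)"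
    using assms by (simp add: powr_diff powr_minus powr_powr[symmetric] powr_realpow divide_inverse)
  finally show ?thesis .
qed

section \<open>Frobenius number far from 2m, and bounded multiplicity\<close>

lemma negligible_large_frobenius:
  fixes \<epsilon> :: real
  assumes "0 < \<epsilon>"
  shows "negligible (\<lambda>S. (2 + \<epsilon>) * real (multiplicity S) \<le> real (frobenius S))"
proof -
  \<comment> \<open>The cap at 1 gives \<open>n \<le> m\<close>, as \<open>sum_far_le\<close>
    demands for q at least 3; for q = 2 the assumption gives t at least \<epsilon> m.\<close>
  define \<eta> where "\<eta> = min \<epsilon> 1"
  define \<tau> where "\<tau> = \<theta> powr \<eta>"
  have \<eta>: "0 < \<eta>" "\<eta> \<le> \<epsilon>" "\<eta> \<le> 1" using assms by (auto simp: \<eta>_def)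
  have "\<theta> powr \<eta> < \<theta> powr 0"
    using theta_pos theta_less_1 \<eta> by (intro powr_less_mono') auto
  then have \<tau>: "0 < \<tau>" "\<tau> < 1" using theta_pos by (simp_all add: \<tau>_def)
  show ?thesis
  proof (rule negligibleI)
    show "summable (\<lambda>m. 16 / (1 - gr) * (real m ^ 2 * \<tau> ^ m))"
      by (intro summable_mult summable_square_power \<tau>)
    fix m X assume X: "finite X" "X \<subseteq> proper_semigroups m"
      and P: "\<And>S. S \<in> X \<Longrightarrow> (2 + \<epsilon>) * real (multiplicity S) \<le> real (frobenius S)"
    define n where "n = nat \<lceil>\<eta> * real m\<rceil>"
    have n_le: "n \<le> k" if "\<eta> * real m \<le> real k" for k
      using that by (simp add: n_def nat_le_iff ceiling_le_iff)
    have "(\<Sum>S\<in>X. gr ^ genus S) \<le> 16 / (1 - gr) * real m ^ 2 * \<theta> ^ n"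
    proof (rule sum_far_le[OF X])
      fix S assume S: "S \<in> X"
      then have mS: "multiplicity S = m" using X(2) by (auto simp: proper_semigroups_def)
      have F: "2 * real m + \<epsilon> * real m \<le> real (frobenius S)" using P[OF S] mS by (simp add: algebra_simps)
      have "0 \<le> \<epsilon> * real m" using assms by simp
      then have "2 * m \<le> frobenius S" using F by linarith
      moreover have "n \<le> frobenius S mod m" if "frobenius S div m = 2"
      proof (rule n_le)
        have "frobenius S = 2 * m + frobenius S mod m"
          using div_mult_mod_eq[of "frobenius S" m] that by simp
        then have "real (frobenius S) = 2 * real m + real (frobenius S mod m)"
          by (metis of_nat_add of_nat_mult of_nat_numeral)
        moreover have "\<eta> * real m \<le> \<epsilon> * real m" using \<eta> by (intro mult_right_mono) auto
        ultimately show "\<eta> * real m \<le> real (frobenius S mod m)" using F by linarith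
      qed
      moreover have "n \<le> m" using \<eta> by (intro n_le) (simp add: mult_left_le_one_le)
      ultimately show "2 * m \<le> frobenius S \<and> n \<le> (if frobenius S div m = 2 then frobenius S mod m else m)"
        by simp
    qed
    also have "\<theta> ^ n \<le> \<tau> ^ m"
      using power_le_powr_power[of \<theta> \<eta> m 0 n] theta_pos theta_less_1 real_nat_ceiling_ge[of "\<eta> * real m"]
      by (simp add: \<tau>_def n_def)
    finally show "(\<Sum>S\<in>X. gr ^ genus S) \<le> 16 / (1 - gr) * (real m ^ 2 * \<tau> ^ m)"
      using gr_less_1 by (simp add: mult_left_mono mult.assoc divide_right_mono)
  qed
qed

lemma negligible_small_frobenius:
  fixes \<epsilon> :: real
  assumes "0 < \<epsilon>" "\<epsilon> \<le> 1"
  shows "negligible (\<lambda>S. real (frobenius S) \<le> (2 - \<epsilon>) * real (multiplicity S))"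
proof (rule negligibleI)
  define \<tau> where "\<tau> = gr powr \<epsilon>"
  have "gr powr \<epsilon> < gr powr 0"
    using gr_pos gr_less_1 assms by (intro powr_less_mono') auto
  then have \<tau>: "0 < \<tau>" "\<tau> < 1" using gr_pos by (simp_all add: \<tau>_def)
  then show "summable (\<lambda>m. \<tau> ^ m * gr powr (- 1))"
    by (intro summable_mult2 summable_geometric) simp
  fix m X assume X: "finite X" "X \<subseteq> proper_semigroups m"
    and P: "\<And>S. S \<in> X \<Longrightarrow> real (frobenius S) \<le> (2 - \<epsilon>) * real (multiplicity S)"
  define k where "k = nat \<lfloor>(1 - \<epsilon>) * real m\<rfloor>"
  define D where "D i = (if i \<le> k then {1, 2 :: nat} else {1})" for i
  have "(\<Sum>S\<in>X. gr ^ genus S) \<le> (\<Prod>i\<in>{0<..<m}. \<Sum>j\<in>D i. gr ^ j)"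
  proof (rule sum_power_genus_le_prod[OF X])
    fix S i assume S: "S \<in> X" and i: "0 < i" "i < m"
    interpret proper_semigroup S using X(2) S by (auto simp: proper_semigroups_def)
    have mS: "multiplicity S = m" using X(2) S by (auto simp: proper_semigroups_def)
    have F: "real (frobenius S) \<le> 2 * real m - \<epsilon> * real m" using P[OF S] mS by (simp add: algebra_simps)
    have "0 < \<epsilon> * real m" using assms i by simp
    then have "frobenius S < 2 * m" using F by linarith
    then have "frobenius S div m < 2" by (rule less_mult_imp_div_less)
    then have k2: "1 \<le> kunz S i" "kunz S i \<le> 2" using kunz_pos[of i] kunz_le(1)[of i] i mS by auto
    moreover have "i \<le> k" if "kunz S i = 2"
    proof -
      have "i + m \<le> frobenius S"
        using gap_le_frobenius[OF gap_kunz[of i]] i mS that by simp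
      then have "real i \<le> (1 - \<epsilon>) * real m" using F by (simp add: algebra_simps)
      then show ?thesis unfolding k_def by (simp add: le_nat_iff le_floor_iff)
    qed
    ultimately show "kunz S i \<in> D i" by (force simp: D_def)
  qed (use gr_pos in \<open>auto simp: D_def\<close>)
  \<comment> \<open>An index free in {1, 2} weighs gr + gr^2 = 1, so only the forced indices beyond
    k produce decay.\<close>
  also have "\<dots> \<le> (\<Prod>i\<in>{0<..<m}. if i \<le> k then 1 else gr)"
    using gr_pos gr_powers(1) by (intro prod_mono) (auto simp: D_def)
  also have "\<dots> = gr ^ card ({0<..<m} \<inter> - {i. i \<le> k})"
    by (simp add: prod.If_cases)
  also have "\<dots> \<le> gr ^ (m - 1 - k)"
  proof -
    have "{k<..<m} \<subseteq> {0<..<m} \<inter> - {i. i \<le> k}" by auto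
    from card_mono[OF _ this] have "m - 1 - k \<le> card ({0<..<m} \<inter> - {i. i \<le> k})" by simp
    then show ?thesis using gr_pos gr_less_1 by (intro power_decreasing) auto
  qed
  also have "\<dots> \<le> \<tau> ^ m * gr powr (- 1)"
    unfolding \<tau>_def
  proof (rule power_le_powr_power)
    have "real k \<le> (1 - \<epsilon>) * real m" using assms by (simp add: k_def)
    then have "\<epsilon> * real m - 1 \<le> real m - 1 - real k" by (simp add: algebra_simps)
    also have "\<dots> \<le> real (m - 1 - k)" by linarith
    finally show "\<epsilon> * real m - 1 \<le> real (m - 1 - k)" .
  qed (use gr_pos gr_less_1 in auto)
  finally show "(\<Sum>S\<in>X. gr ^ genus S) \<le> \<tau> ^ m * gr powr (- 1)" .
qed

lemma negligible_multiplicity_less: "negligible (\<lambda>S. multiplicity S < M)"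
proof (rule negligibleI)
  show "summable (\<lambda>m. if m < M then (1 / (1 - gr)) ^ card {0<..<m} else 0)"
    by (rule summable_finite[of "{..<M}"]) auto
  fix m X assume X: "finite X" "X \<subseteq> proper_semigroups m" and P: "\<And>S. S \<in> X \<Longrightarrow> multiplicity S < M"
  show "(\<Sum>S\<in>X. gr ^ genus S) \<le> (if m < M then (1 / (1 - gr)) ^ card {0<..<m} else 0)"
  proof (cases "m < M")
    case True
    \<comment> \<open>A common bound exists because X is finite; the geometric series makes the
      final estimate independent of it.\<close>
    define G where "G = Max (insert 0 (\<Union>S\<in>X. kunz S ` {0<..<m}))"
    have "(\<Sum>S\<in>X. gr ^ genus S) \<le> (\<Prod>i\<in>{0<..<m}. \<Sum>j\<in>{..G}. gr ^ j)"
    proof (rule sum_power_genus_le_prod[OF X])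
      fix S i assume "S \<in> X" "0 < i" "i < m"
      then show "kunz S i \<in> {..G}" unfolding G_def using X(1) by (auto intro!: Max_ge)
    qed (use gr_pos in auto)
    also have "\<dots> \<le> (\<Prod>i\<in>{0<..<m}. 1 / (1 - gr))"
      using gr_pos by (intro prod_mono conjI sum_gr_le sum_nonneg) auto
    finally show ?thesis using True by simp
  next
    case False
    then have "X = {}" using X(2) P by (fastforce simp: proper_semigroups_def)
    then show ?thesis using False by simp
  qed
qed

section \<open>Chernoff bound for small genus\<close>

lemma exists_chernoff_parameter:
  obtains y :: real where "0 < y" "y < 1" "gr * y + (gr * y) ^ 2 < y powr 1.3667"
proof -
  define f where "f y = y powr 1.3667 - (gr * y + (gr * y) ^ 2)" for y :: real
  \<comment> \<open>f vanishes at 1, and its slope there is 1.3667 minus the mean gr + 2 gr^2 = 2 -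
    gr, about -0.015; hence f is positive just left of 1.\<close>
  have "(f has_real_derivative (1.3667 - (gr + 2 * gr ^ 2))) (at 1)"
    unfolding f_def by (auto intro!: derivative_eq_intros simp: power2_eq_square algebra_simps)
  moreover have "1.3667 - (gr + 2 * gr ^ 2) < 0"
    using gr_bounds unfolding gr_powers(1) by simp
  ultimately obtain d where d: "0 < d" "\<And>h. 0 < h \<Longrightarrow> h < d \<Longrightarrow> f 1 < f (1 - h)"
    using DERIV_neg_dec_left by blast
  define h where "h = min (d / 2) (1 / 2)"
  have h: "0 < h" "h < d" "h < 1" using d(1) by (auto simp: h_def)
  have "f 1 = 0" using gr_powers(1) by (simp add: f_def)
  then have "0 < f (1 - h)" using d(2)[OF h(1,2)] by simp
  then show ?thesis using that[of "1 - h"] h by (simp add: f_def)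
qed

lemma negligible_genus_less: "negligible (\<lambda>S. real (genus S) < 1.3667 * real (multiplicity S))"
proof -
  obtain y :: real where y: "0 < y" "y < 1" "gr * y + (gr * y) ^ 2 < y powr 1.3667"
    by (rule exists_chernoff_parameter)
  define z where "z = gr * y"
  define u where "u = z + z ^ 2"
  define v where "v = u / y powr 1.3667"
  \<comment> \<open>Indices up to \<epsilon> m may also have coordinate 3, which costs a factor 2
    each; half the logarithm keeps \<open>2 powr \<epsilon> * v < 1\<close>. The cap 1 keeps F below
    3m, which excludes coordinates above 3.\<close>
  define \<epsilon> where "\<epsilon> = min 1 (log 2 (1 / v) / 2)"
  have z: "0 < z" "z < 1" using y gr_pos gr_less_1 mult_strict_mono[of gr 1 y 1] by (simp_all add: z_def)
  then have u: "0 < u" by (simp add: u_def add_pos_pos)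
  have v: "0 < v" "v < 1" using u y by (simp_all add: v_def u_def z_def)
  then have log_v: "0 < log 2 (1 / v)" by simp
  then have \<epsilon>: "0 < \<epsilon>" "\<epsilon> \<le> 1" by (simp_all add: \<epsilon>_def)
  have "2 powr \<epsilon> < 2 powr (log 2 (1 / v))"
    using log_v by (intro powr_less_mono) (auto simp: \<epsilon>_def)
  then have \<tau>: "2 powr \<epsilon> * v < 1" using v by (simp add: field_simps)
  have "negligible (\<lambda>S. real (genus S) < 1.3667 * real (multiplicity S)
      \<and> real (frobenius S) < (2 + \<epsilon>) * real (multiplicity S))"
  proof (rule negligibleI)
    show "summable (\<lambda>m. (2 powr \<epsilon> * v) ^ m * (1 / u))"
      using \<tau> v by (intro summable_mult2 summable_geometric) (simp add: abs_mult)
    fix m X assume X: "finite X" "X \<subseteq> proper_semigroups m"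
      and P: "\<And>S. S \<in> X \<Longrightarrow> real (genus S) < 1.3667 * real (multiplicity S)
        \<and> real (frobenius S) < (2 + \<epsilon>) * real (multiplicity S)"
    have S: "proper_semigroup S" "multiplicity S = m" if "S \<in> X" for S
      using X(2) that by (auto simp: proper_semigroups_def)
    show "(\<Sum>S\<in>X. gr ^ genus S) \<le> (2 powr \<epsilon> * v) ^ m * (1 / u)"
    proof (cases "X = {}")
      case True
      then show ?thesis using v u by simp
    next
      case False
      then have "2 \<le> m" using S proper_semigroup.multiplicity_ge_2 by blast
      define D where "D i = (if real i \<le> \<epsilon> * real m then {1, 2, 3 :: nat} else {1, 2})" for i
      \<comment> \<open>Exponential tilting: as y < 1 and the genus is below 1.3667 m, the base gr
        may be lowered to z = gr y at the price of \<open>1 / y powr 1.3667\<close> per unit of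
        m.\<close>
      have "gr ^ genus S \<le> z ^ genus S * (1 / y powr 1.3667) ^ m" if "S \<in> X" for S
      proof -
        have "(y powr 1.3667) ^ m = y powr (1.3667 * real m)"
          unfolding powr_powr[symmetric] using y by (simp add: powr_realpow)
        also have "\<dots> \<le> y powr real (genus S)"
          using P[OF that] S[OF that] y by (intro powr_mono') auto
        also have "\<dots> = y ^ genus S" using y by (simp add: powr_realpow)
        finally have "gr ^ genus S * (y powr 1.3667) ^ m \<le> gr ^ genus S * y ^ genus S"
          using gr_pos by (intro mult_left_mono) auto
        then show ?thesis
          using y by (simp add: z_def power_mult_distrib power_divide field_simps)
      qed
      then have "(\<Sum>S\<in>X. gr ^ genus S) \<le> (\<Sum>S\<in>X. z ^ genus S) * (1 / y powr 1.3667) ^ m"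
        unfolding sum_distrib_right by (rule sum_mono)
      also have "(\<Sum>S\<in>X. z ^ genus S) \<le> 2 powr (\<epsilon> * real m) * u ^ (m - 1)"
      proof -
        have "(\<Sum>S\<in>X. z ^ genus S) \<le> (\<Prod>i\<in>{0<..<m}. \<Sum>j\<in>D i. z ^ j)"
        proof (rule sum_power_genus_le_prod[OF X])
          fix S i assume SX: "S \<in> X" and i: "0 < i" "i < m"
          interpret proper_semigroup S by (rule S[OF SX])
          have mS: "multiplicity S = m" by (rule S[OF SX])
          have F: "real (frobenius S) < 2 * real m + \<epsilon> * real m" using P[OF SX] mS by (simp add: algebra_simps)
          have "\<epsilon> * real m \<le> 1 * real m" using \<epsilon> by (intro mult_right_mono) auto
          then have "frobenius S < 3 * m" using F by linarith
          then have "frobenius S div m < 3" by (rule less_mult_imp_div_less)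
          then have k3: "1 \<le> kunz S i" "kunz S i \<le> 3" using kunz_pos[of i] kunz_le(1)[of i] i mS by auto
          moreover have "real i \<le> \<epsilon> * real m" if "kunz S i = 3"
          proof -
            have "i + 2 * m \<le> frobenius S"
              using gap_le_frobenius[OF gap_kunz[of i]] i mS that by simp
            then show ?thesis using F by linarith
          qed
          moreover have "kunz S i = 1 \<or> kunz S i = 2 \<or> kunz S i = 3" using k3 by linarith
          ultimately show "kunz S i \<in> D i" by (auto simp: D_def)
        qed (use z in \<open>auto simp: D_def\<close>)
        also have "\<dots> \<le> (\<Prod>i\<in>{0<..<m}. (if real i \<le> \<epsilon> * real m then 2 else 1) * u)"
        proof (intro prod_mono conjI)
          fix i
          have "z ^ 3 \<le> u" using z power_decreasing[of 1 3 z] by (simp add: u_def add_increasing2)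
          then show "(\<Sum>j\<in>D i. z ^ j) \<le> (if real i \<le> \<epsilon> * real m then 2 else 1) * u"
            by (simp add: D_def u_def)
        qed (use z in \<open>auto intro: sum_nonneg\<close>)
        also have "\<dots> = 2 ^ card ({0<..<m} \<inter> {i. real i \<le> \<epsilon> * real m}) * u ^ (m - 1)"
          by (simp add: prod.distrib prod.If_cases)
        also have "\<dots> \<le> 2 powr (\<epsilon> * real m) * u ^ (m - 1)"
        proof (rule mult_right_mono)
          have "{0<..<m} \<inter> {i. real i \<le> \<epsilon> * real m} \<subseteq> {0<..nat \<lfloor>\<epsilon> * real m\<rfloor>}"
            by (auto simp: le_nat_iff le_floor_iff)
          from card_mono[OF _ this]
          have "real (card ({0<..<m} \<inter> {i. real i \<le> \<epsilon> * real m})) \<le> real (nat \<lfloor>\<epsilon> * real m\<rfloor>)" by simp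
          also have "\<dots> \<le> \<epsilon> * real m" using \<epsilon> by simp
          finally have "2 powr real (card ({0<..<m} \<inter> {i. real i \<le> \<epsilon> * real m})) \<le> 2 powr (\<epsilon> * real m)"
            by (intro powr_mono) auto
          then show "2 ^ card ({0<..<m} \<inter> {i. real i \<le> \<epsilon> * real m}) \<le> 2 powr (\<epsilon> * real m)"
            by (simp add: powr_realpow)
        qed (use u in simp)
        finally show ?thesis .
      qed
      also have "2 powr (\<epsilon> * real m) * u ^ (m - 1) * (1 / y powr 1.3667) ^ m = (2 powr \<epsilon> * v) ^ m * (1 / u)"
      proof -
        have "u ^ m = u ^ (m - 1) * u" using \<open>2 \<le> m\<close> by (cases m) auto
        moreover have "2 powr (\<epsilon> * real m) = (2 powr \<epsilon>) ^ m"
          by (simp add: powr_powr[symmetric] powr_realpow)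
        ultimately show ?thesis
          using u by (simp add: v_def power_mult_distrib power_divide)
      qed
      finally show ?thesis using y by (simp add: mult_right_mono)
    qed
  qed
  from negligible_disj[OF this negligible_large_frobenius[OF \<epsilon>(1)]] show ?thesis
    by (rule negligible_mono) auto
qed

theorem theorem4:
  fixes N B C :: "nat \<Rightarrow> nat" and A :: "real \<Rightarrow> nat \<Rightarrow> nat"
  defines "N \<equiv> \<lambda>g. card (semigroups_of_genus g)"
    and "A \<equiv> \<lambda>\<epsilon> g. card {S \<in> semigroups_of_genus g.
            (2 - \<epsilon>) * real (multiplicity S) < real (frobenius S) \<and>
            real (frobenius S) < (2 + \<epsilon>) * real (multiplicity S)}"
    and "B \<equiv> \<lambda>g. card {S \<in> semigroups_of_genus g. multiplicity S < 420}"
    and "C \<equiv> \<lambda>g. card {S \<in> semigroups_of_genus g.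
            real g < 1.3667 * real (multiplicity S)}"
  shows "(\<forall>\<epsilon>>0. (\<lambda>g. real (A \<epsilon> g) / real (N g)) \<longlonglongrightarrow> 1)
    \<and> (\<lambda>g. real (B g) / real (N g)) \<longlonglongrightarrow> 0
    \<and> (\<lambda>g. real (C g) / real (N g)) \<longlonglongrightarrow> 0"
proof (intro conjI allI impI)
  fix \<epsilon> :: real assume \<epsilon>: "0 < \<epsilon>"
  define P where "P S \<longleftrightarrow> (2 - \<epsilon>) * real (multiplicity S) < real (frobenius S) \<and>
            real (frobenius S) < (2 + \<epsilon>) * real (multiplicity S)" for S
  \<comment> \<open>\<open>negligible_small_frobenius\<close> takes a parameter of at most 1;
    passing from \<epsilon> to a smaller \<eta> only enlarges the family to be excluded.\<close>
  define \<eta> where "\<eta> = min \<epsilon> 1"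
  have \<eta>: "0 < \<eta>" "\<eta> \<le> 1" "\<eta> \<le> \<epsilon>" using \<epsilon> by (auto simp: \<eta>_def)
  have "negligible (\<lambda>S. \<not> P S)"
  proof (rule negligible_mono[OF negligible_disj[OF negligible_small_frobenius[OF \<eta>(1,2)] negligible_large_frobenius[OF \<epsilon>]]])
    fix S assume "\<not> P S"
    moreover have "(2 - \<epsilon>) * real (multiplicity S) \<le> (2 - \<eta>) * real (multiplicity S)"
      using \<eta> by (intro mult_right_mono) auto
    ultimately show "real (frobenius S) \<le> (2 - \<eta>) * real (multiplicity S)
        \<or> (2 + \<epsilon>) * real (multiplicity S) \<le> real (frobenius S)"
      by (auto simp: P_def)
  qed
  then have "(\<lambda>g. 1 - real (card {S \<in> semigroups_of_genus g. \<not> P S}) / real (N g)) \<longlonglongrightarrow> 1 - 0"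
    unfolding negligible_def N_def by (intro tendsto_intros)
  moreover have "1 - real (card {S \<in> semigroups_of_genus g. \<not> P S}) / real (N g) = real (A \<epsilon> g) / real (N g)" for g
  proof -
    have "semigroups_of_genus g = {S \<in> semigroups_of_genus g. P S} \<union> {S \<in> semigroups_of_genus g. \<not> P S}"
      by blast
    then have "N g = card ({S \<in> semigroups_of_genus g. P S} \<union> {S \<in> semigroups_of_genus g. \<not> P S})"
      by (simp only: N_def)
    also have "\<dots> = card {S \<in> semigroups_of_genus g. P S} + card {S \<in> semigroups_of_genus g. \<not> P S}"
      by (rule card_Un_disjoint) (auto simp: finite_semigroups_of_genus)
    finally have "real (N g) = real (A \<epsilon> g) + real (card {S \<in> semigroups_of_genus g. \<not> P S})"
      by (simp add: A_def P_def)
    moreover have "real (N g) \<noteq> 0" using card_semigroups_pos[of g] by (simp add: N_def)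
    ultimately show ?thesis by (simp add: field_simps)
  qed
  ultimately show "(\<lambda>g. real (A \<epsilon> g) / real (N g)) \<longlonglongrightarrow> 1" by simp
next
  show "(\<lambda>g. real (B g) / real (N g)) \<longlonglongrightarrow> 0"
    using negligible_multiplicity_less[of 420] unfolding negligible_def B_def N_def .
next
  have "{S \<in> semigroups_of_genus g. real (genus S) < 1.3667 * real (multiplicity S)}
      = {S \<in> semigroups_of_genus g. real g < 1.3667 * real (multiplicity S)}" for g
    by (auto simp: semigroups_of_genus_def)
  then show "(\<lambda>g. real (C g) / real (N g)) \<longlonglongrightarrow> 0"
    using negligible_genus_less unfolding negligible_def C_def N_def by (simp only:)
qed

end
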